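(* Let $G$ be a finite nilpotent group (implicitly a sequence with $|G|\to\infty$, together with a sequence of integers $k$). Set $\overline G:=\bigoplus_{\ell=1}^L(G_{(\ell-1)}/G_{(\ell)})$, where $(G_{(\ell)})_{\ell\ge0}$ is the lower central series of $G$ and $L:=\min\{\ell\ge0: G_{(\ell)}=\{\mathrm{id}\}\}$. Then, for all $c>0$, there exists a $c'>0$ so that if $k-d(\overline G)\ge c\log|G|$, then $\Phi_*(G_k)\ge c'$ with high probability.
   Context: All objects are implicitly sequences indexed by $N\to\infty$ with $|G_N|\to\infty$; "with high probability" means with probability tending to 1. $d(A)$ is the minimal size of a generating set of the group $A$. Lower central series: $G_{(0)}=G$, $G_{(\ell)}=[G_{(\ell-1)},G]$ for $\ell\ge1$. $G_k$ is the random Cayley (multi)graph of $G$ with respect to $k$ generators $Z_1,\dots,Z_k$ chosen independently and uniformly at random from $G$: vertex set $G$ and edge multiset $[\{g,gz\}: g\in G, z\in Z]$ (undirected) or $[(g,gz): g\in G,z\in Z]$ (directed); the statement holds for either. Isoperimetric constant: for a finite $d$-regular graph with vertex set $V$ and edge multiset $E$, $$\Phi_*=\min_{1\le|S|\le\frac12|V|}\Phi(S),\qquad \Phi(S)=\frac{\big|[\{a,b\}\in E: a\in S,\ b\in S^c]\big|}{d\,|S|},$$ edges being counted with multiplicity (for the directed graph, edges from $S$ to $S^c$ are counted and $d=k$ is the out-degree; equivalently, $\Phi_*$ is the isoperimetric constant of the nearest-neighbour random walk, which takes the same value for the directed and undirected Cayley graphs with the same generators). *)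

theory Defs
  imports "HOL-Algebra.Algebra" "HOL-Probability.Probability"
begin

definition commutator_subgroup :: "('a, 'b) monoid_scheme \<Rightarrow> 'a set \<Rightarrow> 'a set \<Rightarrow> 'a set" where
  "commutator_subgroup G A B =
     generate G {a \<otimes>\<^bsub>G\<^esub> b \<otimes>\<^bsub>G\<^esub> inv\<^bsub>G\<^esub> a \<otimes>\<^bsub>G\<^esub> inv\<^bsub>G\<^esub> b | a b. a \<in> A \<and> b \<in> B}"

primrec lower_central :: "('a, 'b) monoid_scheme \<Rightarrow> nat \<Rightarrow> 'a set" where
  "lower_central G 0 = carrier G"
| "lower_central G (Suc l) = commutator_subgroup G (lower_central G l) (carrier G)"

definition nilpotent_group :: "('a, 'b) monoid_scheme \<Rightarrow> bool" where
  "nilpotent_group G \<longleftrightarrow> group G \<and> (\<exists>l. lower_central G l = {\<one>\<^bsub>G\<^esub>})"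

definition nilpotency_class :: "('a, 'b) monoid_scheme \<Rightarrow> nat" where
  "nilpotency_class G = (LEAST l. lower_central G l = {\<one>\<^bsub>G\<^esub>})"

definition lower_central_sum :: "('a, 'b) monoid_scheme \<Rightarrow> (nat \<Rightarrow> 'a set) monoid" where
  "lower_central_sum G =
     sum_group {1..nilpotency_class G}
       (\<lambda>l. (G\<lparr>carrier := lower_central G (l - 1)\<rparr>) Mod lower_central G l)"

definition min_gen_size :: "('a, 'b) monoid_scheme \<Rightarrow> nat" where
  "min_gen_size A =
     (LEAST n. \<exists>S. S \<subseteq> carrier A \<and> finite S \<and> card S = n \<and> generate A S = carrier A)"

(* An undirected multigraph is given by its vertex set and a multiset of edges {a, b}
   (a loop at a is the singleton {a}); a directed one by a multiset of pairs. In both cases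
   d is the degree (the out-degree, respectively) of the regular graph. *)

definition undirected_boundary :: "'v set \<Rightarrow> 'v set multiset \<Rightarrow> 'v set \<Rightarrow> 'v set multiset" where
  "undirected_boundary V E S = {# e \<in># E. \<exists>a \<in> S. \<exists>b \<in> V - S. e = {a, b} #}"

definition directed_boundary ::
    "'v set \<Rightarrow> ('v \<times> 'v) multiset \<Rightarrow> 'v set \<Rightarrow> ('v \<times> 'v) multiset" where
  "directed_boundary V E S = {# e \<in># E. fst e \<in> S \<and> snd e \<in> V - S #}"

definition undirected_isoperimetric :: "nat \<Rightarrow> 'v set \<Rightarrow> 'v set multiset \<Rightarrow> real" where
  "undirected_isoperimetric d V E =
     Min {real (size (undirected_boundary V E S)) / (real d * real (card S)) | S.
            S \<subseteq> V \<and> 1 \<le> card S \<and> real (card S) \<le> real (card V) / 2}"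

definition directed_isoperimetric :: "nat \<Rightarrow> 'v set \<Rightarrow> ('v \<times> 'v) multiset \<Rightarrow> real" where
  "directed_isoperimetric d V E =
     Min {real (size (directed_boundary V E S)) / (real d * real (card S)) | S.
            S \<subseteq> V \<and> 1 \<le> card S \<and> real (card S) \<le> real (card V) / 2}"

definition undirected_cayley_edges :: "('a, 'b) monoid_scheme \<Rightarrow> 'a list \<Rightarrow> 'a set multiset" where
  "undirected_cayley_edges G zs =
     image_mset (\<lambda>(g, i). {g, g \<otimes>\<^bsub>G\<^esub> zs ! i}) (mset_set (carrier G \<times> {..<length zs}))"

definition directed_cayley_edges :: "('a, 'b) monoid_scheme \<Rightarrow> 'a list \<Rightarrow> ('a \<times> 'a) multiset" where
  "directed_cayley_edges G zs =
     image_mset (\<lambda>(g, i). (g, g \<otimes>\<^bsub>G\<^esub> zs ! i)) (mset_set (carrier G \<times> {..<length zs}))"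

(* Each generator z contributes to the degree of g both {g, g z} and {g z\<^sup>-\<^sup>1, g};
   loops and involutions are not treated specially, so the undirected degree is 2 k. *)
definition undirected_cayley_isoperimetric :: "('a, 'b) monoid_scheme \<Rightarrow> 'a list \<Rightarrow> real" where
  "undirected_cayley_isoperimetric G zs =
     undirected_isoperimetric (2 * length zs) (carrier G) (undirected_cayley_edges G zs)"

definition directed_cayley_isoperimetric :: "('a, 'b) monoid_scheme \<Rightarrow> 'a list \<Rightarrow> real" where
  "directed_cayley_isoperimetric G zs =
     directed_isoperimetric (length zs) (carrier G) (directed_cayley_edges G zs)"

definition random_generators :: "('a, 'b) monoid_scheme \<Rightarrow> nat \<Rightarrow> 'a list pmf" where
  "random_generators G k = replicate_pmf k (pmf_of_set (carrier G))"

definition with_high_probability :: "(nat \<Rightarrow> 'x pmf) \<Rightarrow> (nat \<Rightarrow> 'x \<Rightarrow> bool) \<Rightarrow> bool" where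
  "with_high_probability p P \<longleftrightarrow>
     (\<lambda>N. measure_pmf.prob (p N) {x. P N x}) \<longlonglongrightarrow> 1"

end

theory Submission
  imports Defs
begin

text \<open>
  Fix a word \<open>w\<close> in \<open>k\<close> letters and let \<open>\<gamma>\<close> be the gcd of its exponent sums \<open>v\<^sub>1, \<dots>, v\<^sub>k\<close>. Choose
  \<open>u\<^sub>i\<close> with \<open>\<Sum>u\<^sub>i v\<^sub>i = \<gamma>\<close>. For \<open>a\<close> in a term of the lower central series, the substitution
  \<open>Z\<^sub>i \<mapsto> Z\<^sub>i a^u\<^sub>i\<close> multiplies the value of \<open>w\<close> by \<open>a^\<gamma>\<close> modulo the next term, since \<open>a\<close> is central there.
  Going down the series, \<open>w\<close> is trivial at uniformly random generators with probability at most
  \<open>1 / |\<gamma> H| \<le> \<gamma>^d(H) / |G|\<close>, where \<open>H\<close> is the direct sum of the lower central factors.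

  Fourier analysis modulo \<open>\<gamma>\<close> shows that for a random word \<open>w\<close> of length \<open>C k\<close> (lazy steps \<open>Z\<^sub>i^(a - b)\<close>
  with random bits \<open>a, b\<close>) all \<open>v\<^sub>i\<close> are divisible by \<open>\<gamma>\<close> with probability about \<open>\<gamma>^-k\<close>, or \<open>\<epsilon>^k\<close> for
  large \<open>\<gamma>\<close>. As \<open>k - d(H) \<ge> c log |G|\<close>, the expectation of \<open>|G| p - 1\<close>, where \<open>p\<close> is the return probability
  of the walk after \<open>C k\<close> steps, is exponentially small in \<open>k\<close>. Hence so is \<open>|G| p - 1\<close> with high probability.

  Finally \<open>|G| p - 1\<close> bounds the squared operator norm of the \<open>(C k / 2)\<close>-th power of the walk on functions of mean
  zero. By log-convexity of \<open>n \<mapsto> \<parallel>P^n f\<parallel>\<^sup>2\<close> the Rayleigh quotient of a centred indicator function is bounded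
  away from 1, which is the isoperimetric inequality.
\<close>

subsection \<open>Symmetric random walks on finite groups\<close>

lemma sum_lists_Suc:
  fixes h :: "'t list \<Rightarrow> 'v::comm_monoid_add"
  shows "(\<Sum>w | set w \<subseteq> T \<and> length w = Suc n. h w) =
    (\<Sum>t\<in>T. \<Sum>w | set w \<subseteq> T \<and> length w = n. h (t # w))"
proof -
  have "(\<Sum>w | set w \<subseteq> T \<and> length w = Suc n. h w)
      = (\<Sum>(t, w)\<in>T \<times> {w. set w \<subseteq> T \<and> length w = n}. h (t # w))"
    by (rule sum.reindex_bij_witness[of _ "\<lambda>(t, w). t # w" "\<lambda>w. (hd w, tl w)"])
       (auto simp: length_Suc_conv)
  then show ?thesis
    by (simp add: sum.cartesian_product)
qed

text \<open>The ratios of consecutive terms of a log-convex sequence do not decrease, so each is at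
  least the first one. Positivity of the terms is carried through the induction so that the ratio
  comparison can be stated in multiplied-out form.\<close>

lemma log_convex_growth:
  fixes a :: "nat \<Rightarrow> real"
  assumes "\<And>j. a (Suc j) ^ 2 \<le> a j * a (Suc (Suc j))" and nonneg: "\<And>j. 0 \<le> a j" and "0 < a 0"
  shows "a 0 * (a 1 / a 0) ^ m \<le> a m"
proof (cases "a 1 = 0")
  case True
  then show ?thesis using nonneg \<open>0 < a 0\<close> by (cases m) auto
next
  case False
  then have a1: "a 1 > 0" using nonneg[of 1] by simp
  have "0 < a m \<and> a m * a 1 \<le> a 0 * a (Suc m)" for m
  proof (induction m)
    case 0
    then show ?case using \<open>0 < a 0\<close> by simp
  next
    case (Suc m)
    have pos: "0 < a (Suc m)"
    proof (rule ccontr)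
      assume "\<not> 0 < a (Suc m)"
      then have "a (Suc m) = 0" using nonneg[of "Suc m"] by simp
      moreover have "0 < a m * a 1" using Suc a1 by simp
      ultimately show False using Suc by simp
    qed
    have "a m * (a (Suc m) * a 1) \<le> a 0 * (a (Suc m))\<^sup>2"
      using Suc pos by (simp add: power2_eq_square mult.assoc mult.left_commute)
    also have "\<dots> \<le> a 0 * (a m * a (Suc (Suc m)))"
      using assms(1)[of m] \<open>0 < a 0\<close> by (intro mult_left_mono) auto
    finally show ?case using Suc pos by (simp add: mult.left_commute)
  qed
  then have step: "a m * (a 1 / a 0) \<le> a (Suc m)" for m
    using \<open>0 < a 0\<close> by (simp add: field_simps)
  show ?thesis
  proof (induction m)
    case (Suc m)
    then have "a 0 * (a 1 / a 0) ^ m * (a 1 / a 0) \<le> a m * (a 1 / a 0)"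
      using a1 \<open>0 < a 0\<close> by (intro mult_right_mono) auto
    then show ?case using step[of m] by (simp add: mult.assoc mult.commute)
  qed simp
qed

text \<open>The steps are indexed by \<open>T\<close> instead of being group elements, so that
  coinciding steps keep their multiplicity. The permutation \<open>\<tau>\<close> pairs each index
  with one of the inverse step, which makes the walk reversible.\<close>

locale symmetric_walk = group +
  fixes T :: "'t set" and \<sigma> :: "'t \<Rightarrow> 'a" and \<tau> :: "'t \<Rightarrow> 't"
  assumes finite_carrier: "finite (carrier G)"
    and finite_T: "finite T" and T_nonempty: "T \<noteq> {}"
    and \<sigma>_closed: "t \<in> T \<Longrightarrow> \<sigma> t \<in> carrier G"
    and \<tau>_bij: "bij_betw \<tau> T T"
    and \<sigma>_\<tau>: "t \<in> T \<Longrightarrow> \<sigma> (\<tau> t) = inv (\<sigma> t)"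
begin

definition ip :: "('a \<Rightarrow> real) \<Rightarrow> ('a \<Rightarrow> real) \<Rightarrow> real" where
  "ip f g = (\<Sum>x\<in>carrier G. f x * g x)"

definition step :: "('a \<Rightarrow> real) \<Rightarrow> 'a \<Rightarrow> real" where
  "step f x = (\<Sum>t\<in>T. f (x \<otimes> \<sigma> t)) / card T"

definition word_value :: "'t list \<Rightarrow> 'a" where
  "word_value w = foldr (\<lambda>t y. \<sigma> t \<otimes> y) w \<one>"

definition return_prob :: "nat \<Rightarrow> real" where
  "return_prob n = card {w. set w \<subseteq> T \<and> length w = n \<and> word_value w = \<one>} / card T ^ n"

lemma card_T_pos: "card T > 0"
  using finite_T T_nonempty by (simp add: card_gt_0_iff)

lemma card_carrier_pos: "card (carrier G) > 0"
  using finite_carrier by (simp add: card_gt_0_iff) blast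

lemma ip_nonneg: "0 \<le> ip f f"
  by (simp add: ip_def sum_nonneg)

lemma ip_Cauchy_Schwarz: "(ip f g)\<^sup>2 \<le> ip f f * ip g g"
  unfolding ip_def using Cauchy_Schwarz_ineq_sum[of f g "carrier G"] by (simp add: power2_eq_square)

lemma sum_translate:
  assumes "a \<in> carrier G"
  shows "(\<Sum>x\<in>carrier G. h (x \<otimes> a)) = (\<Sum>x\<in>carrier G. h x)"
  by (rule sum.reindex_bij_witness[of _ "\<lambda>x. x \<otimes> inv a" "\<lambda>x. x \<otimes> a"])
     (use assms in \<open>auto simp: m_assoc\<close>)

text \<open>The walk is self-adjoint: the adjoint of right translation by \<open>\<sigma> t\<close>
  is translation by its inverse, and \<open>\<tau>\<close> only permutes the indices.\<close>

lemma ip_step: "ip (step f) g = ip f (step g)"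
proof -
  have "(\<Sum>x\<in>carrier G. f (x \<otimes> \<sigma> t) * g x) = (\<Sum>x\<in>carrier G. f x * g (x \<otimes> \<sigma> (\<tau> t)))" if "t \<in> T" for t
    using sum_translate[of "\<sigma> t" "\<lambda>x. f x * g (x \<otimes> \<sigma> (\<tau> t))"] that
    by (simp add: \<sigma>_closed \<sigma>_\<tau> m_assoc)
  then have "(\<Sum>t\<in>T. \<Sum>x\<in>carrier G. f (x \<otimes> \<sigma> t) * g x) = (\<Sum>t\<in>T. \<Sum>x\<in>carrier G. f x * g (x \<otimes> \<sigma> (\<tau> t)))"
    by simp
  also have "\<dots> = (\<Sum>t\<in>T. \<Sum>x\<in>carrier G. f x * g (x \<otimes> \<sigma> t))"
    using sum.reindex_bij_betw[OF \<tau>_bij, of "\<lambda>t. \<Sum>x\<in>carrier G. f x * g (x \<otimes> \<sigma> t)"] by simp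
  finally have "(\<Sum>x\<in>carrier G. \<Sum>t\<in>T. f (x \<otimes> \<sigma> t) * g x) = (\<Sum>x\<in>carrier G. \<Sum>t\<in>T. f x * g (x \<otimes> \<sigma> t))"
    by (simp only: sum.swap[of _ T])
  then show ?thesis
    by (simp add: ip_def step_def sum_distrib_right sum_distrib_left sum_divide_distrib[symmetric])
qed

lemma ip_step_pow: "ip ((step ^^ n) f) g = ip f ((step ^^ n) g)"
proof (induction n arbitrary: f g)
  case (Suc n)
  then show ?case
    by (metis funpow_simps_right(2) comp_apply funpow.simps(2) ip_step)
qed simp

lemma word_value_closed: "set w \<subseteq> T \<Longrightarrow> word_value w \<in> carrier G"
  by (induction w) (auto simp: word_value_def \<sigma>_closed)

lemma step_pow_words:
  assumes "x \<in> carrier G"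
  shows "(step ^^ n) f x = (\<Sum>w | set w \<subseteq> T \<and> length w = n. f (x \<otimes> word_value w)) / card T ^ n"
  using assms
proof (induction n arbitrary: x)
  case 0
  have "{w. set w \<subseteq> T \<and> length w = 0} = {[]}" by auto
  then show ?case using 0 by (simp add: word_value_def)
next
  case (Suc n)
  have "(step ^^ Suc n) f x = (\<Sum>t\<in>T. (\<Sum>w | set w \<subseteq> T \<and> length w = n. f (x \<otimes> \<sigma> t \<otimes> word_value w)) / card T ^ n) / card T"
    using Suc unfolding funpow.simps comp_apply step_def[of "(step ^^ n) f"]
    by (simp add: \<sigma>_closed)
  also have "\<dots> = (\<Sum>t\<in>T. (\<Sum>w | set w \<subseteq> T \<and> length w = n. f (x \<otimes> word_value (t # w)))) / card T ^ Suc n"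
  proof -
    have "x \<otimes> \<sigma> t \<otimes> word_value w = x \<otimes> word_value (t # w)" if "t \<in> T" "set w \<subseteq> T" for t w
      using that Suc.prems word_value_closed[of w] \<sigma>_closed by (simp add: word_value_def m_assoc)
    then have "(\<Sum>t\<in>T. \<Sum>w | set w \<subseteq> T \<and> length w = n. f (x \<otimes> \<sigma> t \<otimes> word_value w))
        = (\<Sum>t\<in>T. \<Sum>w | set w \<subseteq> T \<and> length w = n. f (x \<otimes> word_value (t # w)))"
      by (intro sum.cong) auto
    then show ?thesis
      by (simp add: sum_divide_distrib[symmetric] mult.commute)
  qed
  finally show ?case by (simp add: sum_lists_Suc)
qed

lemma finite_words: "finite {w. set w \<subseteq> T \<and> length w = n}"
  by (rule finite_lists_length_eq[OF finite_T])

lemma step_pow_const: "x \<in> carrier G \<Longrightarrow> (step ^^ n) (\<lambda>_. c) x = c"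
  using card_T_pos by (simp add: step_pow_words card_lists_length_eq[OF finite_T])

lemma step_pow_return:
  assumes "x \<in> carrier G"
  shows "(step ^^ n) (indicator {x}) x = return_prob n"
proof -
  have "(\<Sum>w | set w \<subseteq> T \<and> length w = n. indicator {x} (x \<otimes> word_value w) :: real)
      = (\<Sum>w | set w \<subseteq> T \<and> length w = n. if word_value w = \<one> then 1 else 0)"
    using assms word_value_closed by (intro sum.cong) (auto simp: indicator_def l_cancel_one)
  also have "\<dots> = card {w. set w \<subseteq> T \<and> length w = n \<and> word_value w = \<one>}"
    using finite_words[of n] by (simp add: sum.If_cases Int_def conj_assoc)
  finally show ?thesis
    using assms by (simp add: step_pow_words return_prob_def)
qed

lemma ip_indicator: "x \<in> carrier G \<Longrightarrow> ip (indicator {x}) g = g x"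
  using finite_carrier by (simp add: ip_def indicator_def if_distrib[of "\<lambda>u. u * _"] sum.delta' cong: if_cong)

section \<open>Mixing, the spectral gap and escape from a set\<close>

definition heat :: "nat \<Rightarrow> 'a \<Rightarrow> 'a \<Rightarrow> real" where
  "heat m x y = (step ^^ m) (indicator {x}) y - 1 / card (carrier G)"

text \<open>Self-adjointness joins two walks of \<open>m\<close> steps into one closed walk of
  \<open>2 * m\<close> steps, so the return probability is the squared norm of the
  \<open>m\<close>-step law. Subtracting the uniform law removes
  \<open>1 / card (carrier G)\<close>.\<close>

lemma ip_heat:
  assumes "x \<in> carrier G"
  shows "ip (heat m x) (heat m x) = return_prob (2 * m) - 1 / card (carrier G)"
proof -
  let ?N = "real (card (carrier G))" and ?p = "(step ^^ m) (indicator {x})"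
  have "ip ?p ?p = ip (indicator {x}) ((step ^^ (m + m)) (indicator {x}))"
    by (simp add: ip_step_pow funpow_add)
  also have "\<dots> = return_prob (2 * m)"
    using assms by (simp only: ip_indicator step_pow_return mult_2)
  finally have 1: "ip ?p ?p = return_prob (2 * m)" .
  have "ip ?p (\<lambda>_. 1) = ip (indicator {x}) ((step ^^ m) (\<lambda>_. 1))"
    by (rule ip_step_pow)
  also have "\<dots> = 1"
    using assms by (simp add: ip_indicator step_pow_const)
  finally have 2: "(\<Sum>y\<in>carrier G. ?p y) = 1" by (simp add: ip_def)
  have "ip (heat m x) (heat m x) = (\<Sum>y\<in>carrier G. ?p y * ?p y - (2 / ?N) * ?p y + 1 / ?N * (1 / ?N))"
    by (simp add: ip_def heat_def algebra_simps)
  also have "\<dots> = ip ?p ?p - (2 / ?N) * (\<Sum>y\<in>carrier G. ?p y) + ?N * (1 / ?N * (1 / ?N))"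
    by (simp add: ip_def sum.distrib sum_subtractf sum_distrib_left)
  also have "\<dots> = return_prob (2 * m) - 1 / ?N"
    using card_carrier_pos by (simp add: 1 2)
  finally show ?thesis .
qed

text \<open>Ensures later that the excess of the return probability is nonnegative, as Markov's
  inequality requires.\<close>

lemma return_prob_ge: "1 / card (carrier G) \<le> return_prob (2 * m)"
  using ip_heat[of \<one> m] ip_nonneg[of "heat m \<one>"] by simp

text \<open>A Hilbert-Schmidt bound on functions of mean zero: every value of the iterate is an
  inner product of \<open>f\<close> with \<open>heat m x\<close>, whose norm is the same for all
  \<open>x\<close>. Cauchy-Schwarz bounds the value, and summation over \<open>x\<close> gives the
  factor \<open>card (carrier G)\<close>.\<close>

lemma mixing:
  assumes "(\<Sum>x\<in>carrier G. f x) = 0"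
  shows "ip ((step ^^ m) f) ((step ^^ m) f) \<le> ip f f * (card (carrier G) * return_prob (2 * m) - 1)"
proof -
  let ?N = "real (card (carrier G))"
  have "((step ^^ m) f x)\<^sup>2 \<le> (return_prob (2 * m) - 1 / ?N) * ip f f" if x: "x \<in> carrier G" for x
  proof -
    have "(step ^^ m) f x = ip ((step ^^ m) (indicator {x})) f"
      using x by (simp add: ip_step_pow ip_indicator)
    also have "\<dots> = ip (heat m x) f"
      using assms by (simp add: ip_def heat_def algebra_simps sum_subtractf flip: sum_divide_distrib)
    finally show ?thesis
      using ip_Cauchy_Schwarz[of "heat m x" f] by (simp add: ip_heat[OF x])
  qed
  then have "ip ((step ^^ m) f) ((step ^^ m) f) \<le> (\<Sum>x\<in>carrier G. (return_prob (2 * m) - 1 / ?N) * ip f f)"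
    unfolding ip_def[of "(step ^^ m) f"] by (intro sum_mono) (simp add: power2_eq_square)
  also have "\<dots> = ip f f * (?N * return_prob (2 * m) - 1)"
    using card_carrier_pos by (simp add: field_simps)
  finally show ?thesis .
qed

text \<open>Replaces an eigenvalue argument. The squared norms of the iterates of \<open>f\<close>
  are log-convex by self-adjointness and Cauchy-Schwarz, so a slow decay in the first step would
  persist for all \<open>m\<close> steps and contradict \<open>mixing\<close>.\<close>

lemma rayleigh_bound:
  assumes "(\<Sum>x\<in>carrier G. f x) = 0"
    and "card (carrier G) * return_prob (2 * m) - 1 \<le> r ^ (2 * m)" and "0 \<le> r" and "m > 0"
  shows "ip f (step f) \<le> r * ip f f"
proof (cases "ip f f = 0")
  case True
  then have "(ip f (step f))\<^sup>2 \<le> 0" using ip_Cauchy_Schwarz[of f "step f"] by simp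
  with True show ?thesis by simp
next
  case False
  then have pos: "ip f f > 0" using ip_nonneg[of f] by simp
  define a where "a = (\<lambda>j. ip ((step ^^ j) f) ((step ^^ j) f))"
  have "a (Suc j) = ip ((step ^^ j) f) ((step ^^ Suc (Suc j)) f)" for j
    by (simp add: a_def ip_step)
  then have "a (Suc j) ^ 2 \<le> a j * a (Suc (Suc j))" for j
    using ip_Cauchy_Schwarz[of "(step ^^ j) f" "(step ^^ Suc (Suc j)) f"] by (simp only: a_def)
  then have growth: "a 0 * (a 1 / a 0) ^ m \<le> a m"
    using pos by (intro log_convex_growth) (auto simp: a_def ip_nonneg)
  let ?l = "ip f (step f) / ip f f"
  have "?l\<^sup>2 \<le> a 1 / a 0"
    using ip_Cauchy_Schwarz[of f "step f"] pos by (simp add: a_def power2_eq_square field_simps)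
  then have "(?l\<^sup>2) ^ m \<le> (a 1 / a 0) ^ m" by (intro power_mono) auto
  then have "ip f f * \<bar>?l\<bar> ^ (2 * m) \<le> a 0 * (a 1 / a 0) ^ m"
    unfolding power_mult power2_abs using pos by (simp add: a_def)
  also note growth
  also have "a m \<le> ip f f * r ^ (2 * m)"
    using mixing[OF assms(1), of m] assms(2) pos unfolding a_def
    by (meson mult_left_mono order_trans less_imp_le)
  finally have "\<bar>?l\<bar> ^ (2 * m) \<le> r ^ (2 * m)" using pos by simp
  then have "\<bar>?l\<bar> \<le> r" using assms by (metis power_mono_iff abs_ge_zero mult_pos_pos zero_less_numeral)
  then have "?l \<le> r" by (rule order_trans[OF abs_ge_self])
  then show ?thesis using pos by (simp add: field_simps)
qed

text \<open>The Rayleigh bound is applied to the indicator of \<open>S\<close> minus its mean.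
  Centring changes \<open>ip f f\<close> and \<open>ip f (step f)\<close> by the same amount, so
  their difference is that of the plain indicator, which counts the steps leaving
  \<open>S\<close>.\<close>

lemma escape_bound:
  fixes r :: real
  assumes S: "S \<subseteq> carrier G" and half: "real (card S) \<le> card (carrier G) / 2"
    and "card (carrier G) * return_prob (2 * m) - 1 \<le> r ^ (2 * m)" and "0 \<le> r" "r \<le> 1" and "m > 0"
  shows "(1 - r) * card S / 2 * card T \<le> (\<Sum>t\<in>T. real (card {x \<in> S. x \<otimes> \<sigma> t \<notin> S}))"
proof -
  let ?N = "real (card (carrier G))" and ?s = "real (card S)"
  let ?I = "indicator S :: 'a \<Rightarrow> real"
  define f where "f x = ?I x - ?s / ?N" for x
  have N: "?N > 0" using card_carrier_pos by simp
  have finS: "finite S" using S finite_carrier finite_subset by blast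
  have sumI: "(\<Sum>x\<in>carrier G. ?I x) = ?s"
    using S finite_carrier by (simp add: indicator_def sum.If_cases Int_absorb1)
  have sum0: "(\<Sum>x\<in>carrier G. f x) = 0"
    using N by (simp add: f_def sum_subtractf sumI)
  have "ip f f = (\<Sum>x\<in>carrier G. ?I x * ?I x - 2 * ?s / ?N * ?I x + ?s / ?N * (?s / ?N))"
    unfolding ip_def f_def by (simp add: algebra_simps)
  also have "\<dots> = (\<Sum>x\<in>carrier G. (1 - 2 * ?s / ?N) * ?I x + ?s / ?N * (?s / ?N))"
    by (intro sum.cong) (auto simp: indicator_def)
  also have "\<dots> = ?s - ?s * ?s / ?N"
    using N by (simp add: sum.distrib sumI flip: sum_distrib_left) (simp add: field_simps)
  finally have ff: "ip f f = ?s - ?s * ?s / ?N" .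
  have stepf: "step f x = step ?I x - ?s / ?N" for x
    using card_T_pos by (simp add: step_def f_def sum_subtractf diff_divide_distrib)
  have "(\<Sum>x\<in>carrier G. step ?I x) = ip ?I (step (\<lambda>_. 1))"
    using ip_step[of ?I "\<lambda>_. 1"] by (simp add: ip_def)
  also have "\<dots> = ?s"
    using card_T_pos by (simp add: step_def ip_def sumI)
  finally have sumPI: "(\<Sum>x\<in>carrier G. step ?I x) = ?s" .
  have "ip f (step f) = (\<Sum>x\<in>carrier G. ?I x * step ?I x - ?s / ?N * ?I x - ?s / ?N * step ?I x + ?s / ?N * (?s / ?N))"
    unfolding ip_def stepf f_def by (simp add: algebra_simps)
  also have "\<dots> = ip ?I (step ?I) - ?s * ?s / ?N"
    using N unfolding sum.distrib sum_subtractf sum_distrib_left[symmetric] sumI sumPI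
    by (simp add: ip_def)
  finally have fPf: "ip f (step f) = ip ?I (step ?I) - ?s * ?s / ?N" .
  have bound: "ip f (step f) \<le> r * ip f f"
    using sum0 assms by (intro rayleigh_bound[of f m]) auto
  \<comment> \<open>Here the restriction to at most half of the group enters: the centred indicator
    keeps at least half of the squared norm \<open>?s\<close>.\<close>
  have "?s * ?s / ?N \<le> ?s / 2"
    using half N mult_left_mono[OF half, of ?s] by (simp add: field_simps)
  then have "(1 - r) * (?s / 2) \<le> (1 - r) * ip f f"
    using assms by (intro mult_left_mono) (auto simp: ff)
  also have "\<dots> \<le> ?s - ip ?I (step ?I)"
    using bound ff fPf unfolding left_diff_distrib by linarith
  also have "ip ?I (step ?I) = (\<Sum>x\<in>S. step ?I x)"
    using S finite_carrier unfolding ip_def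
    by (simp add: indicator_def if_distrib[of "\<lambda>u. u * _"] sum.If_cases Int_absorb1 cong: if_cong)
  also have "\<dots> = (\<Sum>t\<in>T. \<Sum>x\<in>S. ?I (x \<otimes> \<sigma> t)) / card T"
    by (simp add: step_def sum.swap[of _ T] flip: sum_divide_distrib)
  also have "?s - \<dots> = (\<Sum>t\<in>T. ?s - (\<Sum>x\<in>S. ?I (x \<otimes> \<sigma> t))) / card T"
    using card_T_pos by (simp add: sum_subtractf diff_divide_distrib)
  also have "(\<Sum>t\<in>T. ?s - (\<Sum>x\<in>S. ?I (x \<otimes> \<sigma> t))) = (\<Sum>t\<in>T. real (card {x \<in> S. x \<otimes> \<sigma> t \<notin> S}))"
  proof (rule sum.cong[OF refl])
    fix t
    have "?s - (\<Sum>x\<in>S. ?I (x \<otimes> \<sigma> t)) = (\<Sum>x\<in>S. 1 - ?I (x \<otimes> \<sigma> t))"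
      by (simp add: sum_subtractf)
    also have "\<dots> = (\<Sum>x\<in>S. if x \<otimes> \<sigma> t \<notin> S then 1 else 0)"
      by (intro sum.cong) (auto simp: indicator_def)
    also have "\<dots> = card {x \<in> S. x \<otimes> \<sigma> t \<notin> S}"
      using finS by (simp add: sum.If_cases Int_def conj_commute)
    finally show "?s - (\<Sum>x\<in>S. ?I (x \<otimes> \<sigma> t)) = card {x \<in> S. x \<otimes> \<sigma> t \<notin> S}" .
  qed
  finally show ?thesis
    using card_T_pos by (simp add: field_simps)
qed

end

subsection \<open>Words along the lower central series\<close>

text \<open>The generators form a function and the exponents are arbitrary integers, so that
  substitutions such as \<open>Z i \<otimes> b [^] u i\<close> can be written directly.\<close>

definition word_eval :: "('a, 'b) monoid_scheme \<Rightarrow> (nat \<Rightarrow> 'a) \<Rightarrow> (nat \<times> int) list \<Rightarrow> 'a" where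
  "word_eval G Z w = foldr (\<lambda>(i, e) y. (Z i [^]\<^bsub>G\<^esub> e) \<otimes>\<^bsub>G\<^esub> y) w \<one>\<^bsub>G\<^esub>"

declare lower_central.simps(2) [simp del]

context group
begin

lemma inv_mult_cancel_left:
  assumes "x \<in> carrier G" "y \<in> carrier G"
  shows "inv x \<otimes> (x \<otimes> y) = y" "x \<otimes> (inv x \<otimes> y) = y"
  using assms by (simp_all add: m_assoc[symmetric])

lemma commutes_int_pow:
  assumes "x \<in> carrier G" "b \<in> carrier G" and comm: "x \<otimes> b = b \<otimes> x"
  shows "x \<otimes> b [^] (n :: int) = b [^] n \<otimes> x"
proof -
  have *: "x \<otimes> b [^] (m :: nat) = b [^] m \<otimes> x" for m
    using group_commutes_pow[OF comm[symmetric]] assms by simp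
  have "x \<otimes> inv (b [^] m) = inv (b [^] m) \<otimes> x" for m :: nat
  proof -
    have "inv (b [^] m) \<otimes> x = inv (b [^] m) \<otimes> (x \<otimes> b [^] m) \<otimes> inv (b [^] m)"
      using assms by (simp add: m_assoc)
    also have "\<dots> = x \<otimes> inv (b [^] m)"
      using assms unfolding * by (simp add: inv_mult_cancel_left)
    finally show ?thesis by simp
  qed
  with * show ?thesis unfolding int_pow_def2 by presburger
qed

lemma word_eval_closed:
  assumes "\<And>i. i \<in> fst ` set w \<Longrightarrow> Z i \<in> carrier G"
  shows "word_eval G Z w \<in> carrier G"
  using assms by (induction w) (auto simp: word_eval_def)

text \<open>Powers of a central element can be gathered at the right end of the word; a letter with
  index \<open>i\<close> and exponent \<open>e\<close> contributes \<open>u i * e\<close> to the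
  exponent.\<close>

lemma word_eval_mult_central:
  assumes Z: "\<And>i. i \<in> fst ` set w \<Longrightarrow> Z i \<in> carrier G" and b: "b \<in> carrier G"
    and central: "\<And>x. x \<in> carrier G \<Longrightarrow> x \<otimes> b = b \<otimes> x"
  shows "word_eval G (\<lambda>i. Z i \<otimes> b [^] (u i :: int)) w
    = word_eval G Z w \<otimes> b [^] (\<Sum>(i, e)\<leftarrow>w. u i * e)"
  using Z
proof (induction w)
  case Nil
  then show ?case by (simp add: word_eval_def)
next
  case (Cons p w)
  obtain i e where p: "p = (i, e)" by fastforce
  let ?s = "\<Sum>(i, e)\<leftarrow>w. u i * e"
  have pow_central: "x \<otimes> b [^] (n :: int) = b [^] n \<otimes> x" if "x \<in> carrier G" for x n
    by (rule commutes_int_pow[OF that b central[OF that]])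
  have Zi: "Z i \<in> carrier G" and W: "word_eval G Z w \<in> carrier G"
    using Cons.prems p by (auto intro!: word_eval_closed)
  have "word_eval G (\<lambda>i. Z i \<otimes> b [^] u i) (p # w)
      = (Z i \<otimes> b [^] u i) [^] e \<otimes> (word_eval G Z w \<otimes> b [^] ?s)"
    using Cons by (simp add: p word_eval_def)
  also have "(Z i \<otimes> b [^] u i) [^] e = Z i [^] e \<otimes> b [^] (u i * e)"
    using int_pow_mult_distrib[OF pow_central[OF Zi]] Zi b by (simp add: int_pow_pow)
  also have "\<dots> \<otimes> (word_eval G Z w \<otimes> b [^] ?s)
      = Z i [^] e \<otimes> (b [^] (u i * e) \<otimes> word_eval G Z w) \<otimes> b [^] ?s"
    using Zi b W by (simp add: m_assoc)
  also have "b [^] (u i * e) \<otimes> word_eval G Z w = word_eval G Z w \<otimes> b [^] (u i * e)"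
    by (rule pow_central[OF W, symmetric])
  also have "Z i [^] e \<otimes> (word_eval G Z w \<otimes> b [^] (u i * e)) \<otimes> b [^] ?s
      = Z i [^] e \<otimes> word_eval G Z w \<otimes> b [^] (u i * e + ?s)"
    using Zi b W by (simp add: m_assoc int_pow_mult)
  finally show ?case by (simp add: p word_eval_def)
qed

section \<open>The lower central series and its factors\<close>

lemma lower_central_normal: "lower_central G l \<lhd> G"
proof (induction l)
  case 0
  then show ?case by (simp add: normal_self)
next
  case (Suc l)
  interpret N: normal "lower_central G l" G by (rule Suc)
  show ?case
    unfolding lower_central.simps commutator_subgroup_def
  proof (rule normal_generateI, safe)
    fix a b h g assume a: "a \<in> lower_central G l" and b: "b \<in> carrier G" and g: "g \<in> carrier G"
    have ac: "a \<in> carrier G" using a N.subset by blast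
    then have "g \<otimes> (a \<otimes> b \<otimes> inv a \<otimes> inv b) \<otimes> inv g
      = (g \<otimes> a \<otimes> inv g) \<otimes> (g \<otimes> b \<otimes> inv g) \<otimes> inv (g \<otimes> a \<otimes> inv g) \<otimes> inv (g \<otimes> b \<otimes> inv g)"
      using b g by (simp add: m_assoc inv_mult_group inv_mult_cancel_left)
    then show "\<exists>a' b'. g \<otimes> (a \<otimes> b \<otimes> inv a \<otimes> inv b) \<otimes> inv g = a' \<otimes> b' \<otimes> inv a' \<otimes> inv b'
        \<and> a' \<in> lower_central G l \<and> b' \<in> carrier G"
      using a b g N.inv_op_closed2 by blast
  qed (use N.subset in auto)
qed

lemma lower_central_subgroup: "subgroup (lower_central G l) G"
  using lower_central_normal normal_imp_subgroup by blast

lemma lower_central_subset: "lower_central G l \<subseteq> carrier G"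
  by (rule subgroup.subset[OF lower_central_subgroup])

lemma lower_central_Suc_subset: "lower_central G (Suc l) \<subseteq> lower_central G l"
proof -
  interpret N: normal "lower_central G l" G by (rule lower_central_normal)
  have "a \<otimes> b \<otimes> inv a \<otimes> inv b \<in> lower_central G l" if "a \<in> lower_central G l" "b \<in> carrier G" for a b
  proof -
    have "a \<otimes> (b \<otimes> inv a \<otimes> inv b) \<in> lower_central G l"
      using that N.inv_op_closed2 by blast
    then show ?thesis using that N.subset by (simp add: m_assoc subset_iff)
  qed
  then show ?thesis
    unfolding lower_central.simps commutator_subgroup_def
    by (intro generate_subgroup_incl lower_central_subgroup) auto
qed

lemma commutator_in_lower_central_Suc:
  assumes "a \<in> lower_central G l" and "b \<in> carrier G"
  shows "a \<otimes> b \<otimes> inv a \<otimes> inv b \<in> lower_central G (Suc l)"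
  using assms by (auto simp: lower_central.simps(2) commutator_subgroup_def intro!: generate.incl)

text \<open>An element of one term is central modulo the next term, because
  \<open>a \<otimes> b\<close> is the commutator of \<open>a\<close> and \<open>b\<close> times
  \<open>b \<otimes> a\<close>.\<close>

lemma lower_central_commute_mod:
  assumes a: "a \<in> lower_central G l" and b: "b \<in> carrier G"
  shows "lower_central G (Suc l) #> (a \<otimes> b) = lower_central G (Suc l) #> (b \<otimes> a)"
proof -
  let ?H = "lower_central G (Suc l)"
  interpret H: normal ?H G by (rule lower_central_normal)
  have ac: "a \<in> carrier G" using a lower_central_subset by blast
  have eq: "a \<otimes> b = (a \<otimes> b \<otimes> inv a \<otimes> inv b) \<otimes> (b \<otimes> a)"
    using ac b by (simp add: m_assoc inv_mult_cancel_left)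
  have "?H #> ((a \<otimes> b \<otimes> inv a \<otimes> inv b) \<otimes> (b \<otimes> a)) = ?H #> (a \<otimes> b \<otimes> inv a \<otimes> inv b) #> (b \<otimes> a)"
    using ac b H.subset by (simp add: coset_mult_assoc)
  also have "\<dots> = ?H #> (b \<otimes> a)"
    using commutator_in_lower_central_Suc[OF a b] H.rcos_const by simp
  finally show ?thesis using eq by simp
qed

text \<open>Numbered from 0, so \<open>layer l\<close> is the factor with index \<open>l + 1\<close>
  in \<open>lower_central_sum\<close>.\<close>

definition layer :: "nat \<Rightarrow> 'a set monoid" where
  "layer l = (G\<lparr>carrier := lower_central G l\<rparr>) Mod lower_central G (Suc l)"

lemma layer_normal: "lower_central G (Suc l) \<lhd> (G\<lparr>carrier := lower_central G l\<rparr>)"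
  by (rule normal_restrict_supergroup[OF lower_central_subgroup lower_central_normal lower_central_Suc_subset])

lemma carrier_layer: "carrier (layer l) = (\<lambda>a. lower_central G (Suc l) #> a) ` lower_central G l"
  by (simp add: layer_def carrier_FactGroup r_coset_def)

lemma group_layer: "group (layer l)"
  unfolding layer_def by (rule normal.factorgroup_is_group[OF layer_normal])

lemma mult_layer:
  assumes "a \<in> lower_central G l" "b \<in> lower_central G l"
  shows "(lower_central G (Suc l) #> a) \<otimes>\<^bsub>layer l\<^esub> (lower_central G (Suc l) #> b)
    = lower_central G (Suc l) #> (a \<otimes> b)"
  using normal.rcos_sum[OF lower_central_normal] assms lower_central_subset
  by (simp add: layer_def set_mult_def subset_iff)

lemma comm_group_layer: "comm_group (layer l)"
proof (rule group.group_comm_groupI[OF group_layer])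
  fix x y assume "x \<in> carrier (layer l)" "y \<in> carrier (layer l)"
  then obtain a b where "a \<in> lower_central G l" "b \<in> lower_central G l"
    "x = lower_central G (Suc l) #> a" "y = lower_central G (Suc l) #> b"
    by (auto simp: carrier_layer)
  then show "x \<otimes>\<^bsub>layer l\<^esub> y = y \<otimes>\<^bsub>layer l\<^esub> x"
    using mult_layer lower_central_commute_mod lower_central_subset by (metis subset_iff)
qed

lemma pow_layer:
  assumes "a \<in> lower_central G l"
  shows "(lower_central G (Suc l) #> a) [^]\<^bsub>layer l\<^esub> (n :: nat) = lower_central G (Suc l) #> (a [^] n)"
proof (induction n)
  case 0
  interpret H: normal "lower_central G (Suc l)" G by (rule lower_central_normal)
  show ?case
    using H.subset by (simp add: layer_def)
next
  case (Suc n)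
  have "a [^] n \<in> lower_central G l"
    using assms lower_central_subgroup subgroup_int_pow_closed by (metis int_pow_int)
  with Suc assms show ?case by (simp add: mult_layer)
qed

lemma card_layer:
  assumes "finite (carrier G)"
  shows "card (carrier (layer l)) * card (lower_central G (Suc l)) = card (lower_central G l)"
proof -
  let ?K = "G\<lparr>carrier := lower_central G l\<rparr>"
  have "subgroup (lower_central G (Suc l)) ?K"
    using layer_normal normal_imp_subgroup by blast
  moreover have "group ?K" using lower_central_subgroup subgroup_imp_group by blast
  ultimately have "card (rcosets\<^bsub>?K\<^esub> lower_central G (Suc l)) * card (lower_central G (Suc l)) = card (carrier ?K)"
    using group.lagrange[of ?K "lower_central G (Suc l)"] unfolding Coset.order_def by blast
  then show ?thesis
    by (simp add: layer_def FactGroup_def)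
qed

lemma prod_card_layers:
  assumes "finite (carrier G)"
  shows "(\<Prod>l<L. card (carrier (layer l))) * card (lower_central G L) = card (carrier G)"
proof (induction L)
  case (Suc L)
  then show ?case using card_layer[OF assms, of L] by (simp add: mult.assoc)
qed simp

section \<open>Counting the tuples at which a word falls into a given term of the series\<close>

definition generators_into :: "nat \<Rightarrow> (nat \<times> int) list \<Rightarrow> nat \<Rightarrow> 'a list set" where
  "generators_into k w l =
    {zs. set zs \<subseteq> carrier G \<and> length zs = k \<and> word_eval G ((!) zs) w \<in> lower_central G l}"

lemma word_eval_coset:
  assumes "N \<lhd> G" and "\<And>i. i \<in> fst ` set w \<Longrightarrow> Z i \<in> carrier G"
  shows "word_eval (G Mod N) (\<lambda>i. N #> Z i) w = N #> word_eval G Z w"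
  using assms(2)
proof (induction w)
  interpret N: normal N G by (rule assms(1))
  case Nil
  then show ?case using N.subset by (simp add: word_eval_def)
next
  interpret N: normal N G by (rule assms(1))
  case (Cons p w)
  obtain i e where p: "p = (i, e)" by fastforce
  have "Z i \<in> carrier G" "word_eval G Z w \<in> carrier G"
    using Cons.prems p by (auto intro!: word_eval_closed)
  then have "N #> (Z i [^] e) <#> (N #> word_eval G Z w) = N #> (Z i [^] e \<otimes> word_eval G Z w)"
    by (simp add: N.rcos_sum)
  then show ?case
    using Cons \<open>Z i \<in> carrier G\<close> by (simp add: p word_eval_def N.FactGroup_int_pow)
qed

text \<open>In the quotient by the next term \<open>a\<close> is central, so the substitution
  changes the value only by a power of \<open>a\<close>; the choice of \<open>u\<close> makes the
  exponent equal to \<open>\<gamma>\<close>.\<close>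

lemma word_eval_translate:
  assumes w: "\<And>i e. (i, e) \<in> set w \<Longrightarrow> i < k" and zs: "set zs \<subseteq> carrier G" "length zs = k"
    and a: "a \<in> lower_central G l"
    and u: "(\<Sum>(i, e)\<leftarrow>w. u i * e) = int \<gamma>"
  shows "lower_central G (Suc l) #> word_eval G (\<lambda>i. zs ! i \<otimes> a [^] (u i :: int)) w
    = lower_central G (Suc l) #> (word_eval G ((!) zs) w \<otimes> a [^] \<gamma>)"
proof -
  let ?H = "lower_central G (Suc l)" and ?Q = "G Mod lower_central G (Suc l)"
  interpret H: normal ?H G by (rule lower_central_normal)
  interpret Q: group ?Q by (rule H.factorgroup_is_group)
  have ac: "a \<in> carrier G" using a lower_central_subset by blast
  have zc: "zs ! i \<in> carrier G" if "i \<in> fst ` set w" for i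
    using that w zs by (auto dest!: nth_mem simp: subset_iff)
  have Qc: "?H #> x \<in> carrier ?Q" if "x \<in> carrier G" for x
    using that by (auto simp: carrier_FactGroup)
  have "?H #> word_eval G (\<lambda>i. zs ! i \<otimes> a [^] u i) w = word_eval ?Q (\<lambda>i. ?H #> (zs ! i \<otimes> a [^] u i)) w"
    using zc ac by (intro word_eval_coset[symmetric] lower_central_normal) auto
  also have "\<dots> = word_eval ?Q (\<lambda>i. (?H #> (zs ! i)) \<otimes>\<^bsub>?Q\<^esub> (?H #> a) [^]\<^bsub>?Q\<^esub> u i) w"
    unfolding word_eval_def
  proof (rule foldr_cong)
    fix p y assume "p \<in> set w"
    then have "?H #> (zs ! fst p \<otimes> a [^] u (fst p)) = (?H #> (zs ! fst p)) \<otimes>\<^bsub>?Q\<^esub> (?H #> a) [^]\<^bsub>?Q\<^esub> u (fst p)"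
      using zc ac by (simp add: H.FactGroup_int_pow H.rcos_sum)
    then show "(case p of (i, e) \<Rightarrow> \<lambda>y. ((?H #> (zs ! i \<otimes> a [^] u i)) [^]\<^bsub>?Q\<^esub> e) \<otimes>\<^bsub>?Q\<^esub> y) y
      = (case p of (i, e) \<Rightarrow> \<lambda>y. (((?H #> (zs ! i)) \<otimes>\<^bsub>?Q\<^esub> (?H #> a) [^]\<^bsub>?Q\<^esub> u i) [^]\<^bsub>?Q\<^esub> e) \<otimes>\<^bsub>?Q\<^esub> y) y"
      by (auto split: prod.split)
  qed auto
  also have "\<dots> = word_eval ?Q (\<lambda>i. ?H #> (zs ! i)) w \<otimes>\<^bsub>?Q\<^esub> (?H #> a) [^]\<^bsub>?Q\<^esub> (\<Sum>(i, e)\<leftarrow>w. u i * e)"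
  proof (rule Q.word_eval_mult_central)
    fix x assume "x \<in> carrier ?Q"
    then obtain g where g: "g \<in> carrier G" "x = ?H #> g" by (auto simp: carrier_FactGroup)
    then show "x \<otimes>\<^bsub>?Q\<^esub> (?H #> a) = (?H #> a) \<otimes>\<^bsub>?Q\<^esub> x"
      using lower_central_commute_mod[OF a g(1)] ac by (simp add: H.rcos_sum)
  qed (use zc ac Qc in auto)
  also have "\<dots> = (?H #> word_eval G ((!) zs) w) \<otimes>\<^bsub>?Q\<^esub> (?H #> (a [^] \<gamma>))"
    using zc ac by (simp add: word_eval_coset[OF lower_central_normal] u int_pow_int H.FactGroup_pow)
  also have "\<dots> = ?H #> (word_eval G ((!) zs) w \<otimes> a [^] \<gamma>)"
    using zc ac by (simp add: H.rcos_sum word_eval_closed)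
  finally show ?thesis .
qed

text \<open>Start from a tuple whose word value lies in term \<open>l + 1\<close> and from a
  \<open>\<gamma>\<close>-th power \<open>C\<close> in the layer. Substituting along a root of
  \<open>C\<close> moves the value into the coset \<open>C\<close>, hence into term
  \<open>l\<close>. This map of pairs to tuples is injective, which gives the inequality.\<close>

lemma card_generators_into_Suc:
  assumes fin: "finite (carrier G)" and w: "\<And>i e. (i, e) \<in> set w \<Longrightarrow> i < k"
    and u: "(\<Sum>(i, e)\<leftarrow>w. u i * e) = int \<gamma>"
  shows "card (generators_into k w (Suc l)) * card ((\<lambda>x. x [^]\<^bsub>layer l\<^esub> \<gamma>) ` carrier (layer l))
    \<le> card (generators_into k w l)"
proof -
  let ?H = "lower_central G (Suc l)" and ?X = "generators_into k w"
  let ?R = "(\<lambda>x. x [^]\<^bsub>layer l\<^esub> \<gamma>) ` carrier (layer l)"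
  interpret H: normal ?H G by (rule lower_central_normal)
  have R: "?R = (\<lambda>a. ?H #> (a [^] \<gamma>)) ` lower_central G l"
    unfolding carrier_layer image_image by (intro image_cong refl pow_layer)
  \<comment> \<open>A fixed \<open>\<gamma>\<close>-th root of the coset \<open>C\<close>, chosen in
    term \<open>l\<close>.\<close>
  define rep where "rep C = (SOME a. a \<in> lower_central G l \<and> ?H #> (a [^] \<gamma>) = C)" for C
  have rep: "rep C \<in> lower_central G l \<and> ?H #> (rep C [^] \<gamma>) = C" if "C \<in> ?R" for C
  proof -
    have "\<exists>a. a \<in> lower_central G l \<and> ?H #> (a [^] \<gamma>) = C" using that unfolding R by blast
    then show ?thesis unfolding rep_def by (rule someI_ex)
  qed
  have repc: "rep C \<in> carrier G" if "C \<in> ?R" for C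
    using rep[OF that] lower_central_subset by blast
  define \<Phi> where "\<Phi> = (\<lambda>(zs, C). map (\<lambda>i. zs ! i \<otimes> rep C [^] (u i :: int)) [0..<k])"
  have eval: "word_eval G ((!) (\<Phi> (zs, C))) w \<in> carrier G
      \<and> ?H #> word_eval G ((!) (\<Phi> (zs, C))) w = C"
    if zs: "zs \<in> ?X (Suc l)" and C: "C \<in> ?R" for zs C
  proof -
    have zc: "zs ! i \<in> carrier G" if "i < k" for i
      using zs that by (auto simp: generators_into_def)
    have eq: "word_eval G ((!) (\<Phi> (zs, C))) w = word_eval G (\<lambda>i. zs ! i \<otimes> rep C [^] u i) w"
      unfolding word_eval_def
    proof (rule foldr_cong)
      fix p y assume "p \<in> set w"
      moreover obtain i e where "p = (i, e)" by fastforce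
      ultimately have "p = (i, e)" "i < k" using w by auto
      then show "(case p of (i, e) \<Rightarrow> \<lambda>y. ((\<Phi> (zs, C) ! i) [^] e) \<otimes> y) y
        = (case p of (i, e) \<Rightarrow> \<lambda>y. ((zs ! i \<otimes> rep C [^] u i) [^] e) \<otimes> y) y"
        by (simp add: \<Phi>_def)
    qed auto
    have W: "word_eval G ((!) zs) w \<in> ?H" using zs by (simp add: generators_into_def)
    have "?H #> word_eval G ((!) (\<Phi> (zs, C))) w = ?H #> (word_eval G ((!) zs) w \<otimes> rep C [^] \<gamma>)"
      unfolding eq using zs rep[OF C] by (intro word_eval_translate[OF w _ _ _ u]) (auto simp: generators_into_def)
    also have "\<dots> = ?H #> word_eval G ((!) zs) w #> (rep C [^] \<gamma>)"
      using W H.subset repc[OF C] by (simp add: coset_mult_assoc subset_iff)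
    also have "\<dots> = C" using W rep[OF C] by (simp add: H.rcos_const)
    finally have "?H #> word_eval G ((!) (\<Phi> (zs, C))) w = C" .
    moreover have "word_eval G ((!) (\<Phi> (zs, C))) w \<in> carrier G"
      unfolding eq using zc w repc[OF C] by (intro word_eval_closed) auto
    ultimately show ?thesis by simp
  qed
  \<comment> \<open>The coset \<open>C\<close> is read off from the value of the word at the new
    tuple; it determines \<open>rep C\<close>, and cancelling the powers of \<open>rep C\<close>
    recovers the old tuple.\<close>
  have "inj_on \<Phi> (?X (Suc l) \<times> ?R)"
  proof (rule inj_onI)
    fix p p' assume "p \<in> ?X (Suc l) \<times> ?R" "p' \<in> ?X (Suc l) \<times> ?R" and eq': "\<Phi> p = \<Phi> p'"
    then obtain zs C zs' C' where p: "p = (zs, C)" "p' = (zs', C')"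
      and zs: "zs \<in> ?X (Suc l)" "zs' \<in> ?X (Suc l)" and C: "C \<in> ?R" "C' \<in> ?R"
      by (meson mem_Sigma_iff surj_pair SigmaE)
    have eq: "\<Phi> (zs, C) = \<Phi> (zs', C')" using eq' p by simp
    have CC: "C = C'" using eval[OF zs(1) C(1)] eval[OF zs(2) C(2)] eq by simp
    moreover have "zs ! i = zs' ! i" if "i < k" for i
    proof -
      have "\<Phi> (zs, C) ! i = \<Phi> (zs', C') ! i" using eq by simp
      then have "zs ! i \<otimes> rep C [^] u i = zs' ! i \<otimes> rep C [^] u i"
        using that by (simp add: \<Phi>_def CC)
      moreover have "zs ! i \<in> carrier G" "zs' ! i \<in> carrier G"
        using zs that by (auto simp: generators_into_def)
      ultimately show ?thesis using repc[OF C(1)] by simp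
    qed
    ultimately show "p = p'"
      using zs p by (auto simp: generators_into_def intro!: nth_equalityI)
  qed
  moreover have "\<Phi> ` (?X (Suc l) \<times> ?R) \<subseteq> ?X l"
  proof (rule image_subsetI)
    fix p assume "p \<in> ?X (Suc l) \<times> ?R"
    then obtain zs C where p: "p = (zs, C)" and zs: "zs \<in> ?X (Suc l)" and C: "C \<in> ?R"
      by (rule SigmaE)
    let ?v = "word_eval G ((!) (\<Phi> (zs, C))) w"
    have "?v \<in> ?H #> ?v" using eval[OF zs C] rcos_self[OF _ lower_central_subgroup] by blast
    then have "?v \<in> ?H #> (rep C [^] \<gamma>)" using eval[OF zs C] rep[OF C] by simp
    moreover have "rep C [^] \<gamma> \<in> lower_central G l"
      using rep[OF C] lower_central_subgroup subgroup_int_pow_closed by (metis int_pow_int)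
    ultimately have "?v \<in> lower_central G l"
      using lower_central_Suc_subset[of l] subgroup.m_closed[OF lower_central_subgroup[of l]]
      by (fastforce simp: r_coset_def)
    moreover have "set (\<Phi> (zs, C)) \<subseteq> carrier G"
      using zs repc[OF C] by (auto simp: \<Phi>_def generators_into_def dest: nth_mem intro!: m_closed)
    ultimately show "\<Phi> p \<in> ?X l"
      by (simp add: p generators_into_def \<Phi>_def)
  qed
  moreover have "finite (?X l)"
    by (rule finite_subset[OF _ finite_lists_length_eq[OF fin, of k]]) (auto simp: generators_into_def)
  ultimately show ?thesis
    using card_inj_on_le[of \<Phi> "?X (Suc l) \<times> ?R" "?X l"] by (simp add: card_cartesian_product)
qed

lemma card_generators_into:
  assumes fin: "finite (carrier G)" and w: "\<And>i e. (i, e) \<in> set w \<Longrightarrow> i < k"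
    and u: "(\<Sum>(i, e)\<leftarrow>w. u i * e) = int \<gamma>"
  shows "card (generators_into k w L) * (\<Prod>l<L. card ((\<lambda>x. x [^]\<^bsub>layer l\<^esub> \<gamma>) ` carrier (layer l)))
    \<le> card (carrier G) ^ k"
proof (induction L)
  case 0
  have "generators_into k w 0 \<subseteq> {zs. set zs \<subseteq> carrier G \<and> length zs = k}"
    by (auto simp: generators_into_def)
  then show ?case
    using card_mono[OF finite_lists_length_eq[OF fin, of k]] by (simp add: card_lists_length_eq[OF fin])
next
  case (Suc L)
  let ?r = "\<lambda>l. card ((\<lambda>x. x [^]\<^bsub>layer l\<^esub> \<gamma>) ` carrier (layer l))"
  have "card (generators_into k w (Suc L)) * (\<Prod>l<Suc L. ?r l)
      = card (generators_into k w (Suc L)) * ?r L * (\<Prod>l<L. ?r l)"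
    by simp
  also have "\<dots> \<le> card (generators_into k w L) * (\<Prod>l<L. ?r l)"
    using card_generators_into_Suc[OF fin w u] by (intro mult_right_mono) auto
  also note Suc
  finally show ?case .
qed

end

subsection \<open>Generators of the sum of the lower central factors\<close>

lemma (in comm_group) subgroup_pow_image: "subgroup ((\<lambda>x. x [^] (\<gamma>::nat)) ` carrier G) G"
proof
  show "(\<lambda>x. x [^] \<gamma>) ` carrier G \<subseteq> carrier G" by auto
  show "\<one> \<in> (\<lambda>x. x [^] \<gamma>) ` carrier G" by (rule image_eqI[of _ _ \<one>]) auto
next
  fix x y assume "x \<in> (\<lambda>x. x [^] \<gamma>) ` carrier G" "y \<in> (\<lambda>x. x [^] \<gamma>) ` carrier G"
  then obtain a b where "a \<in> carrier G" "b \<in> carrier G" "x = a [^] \<gamma>" "y = b [^] \<gamma>" by auto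
  then show "x \<otimes> y \<in> (\<lambda>x. x [^] \<gamma>) ` carrier G"
    by (intro image_eqI[of _ _ "a \<otimes> b"]) (auto simp: nat_pow_distrib)
next
  fix x assume "x \<in> (\<lambda>x. x [^] \<gamma>) ` carrier G"
  then obtain a where "a \<in> carrier G" "x = a [^] \<gamma>" by auto
  then show "inv x \<in> (\<lambda>x. x [^] \<gamma>) ` carrier G"
    by (intro image_eqI[of _ _ "inv a"]) (auto simp: nat_pow_inv)
qed

text \<open>All \<open>\<gamma>\<close>-th powers lie in \<open>H\<close>, so exponents of
  \<open>s\<close> matter only modulo \<open>\<gamma>\<close> and \<open>\<gamma>\<close> translates
  of \<open>H\<close> cover the enlarged subgroup.\<close>

lemma (in comm_group) subgroup_adjoin:
  assumes fin: "finite (carrier G)" and H: "subgroup H G" and s: "s \<in> carrier G"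
    and pow: "\<And>x. x \<in> carrier G \<Longrightarrow> x [^] (\<gamma>::nat) \<in> H" and "\<gamma> > 0"
  obtains K where "subgroup K G" "H \<subseteq> K" "s \<in> K" "card K \<le> \<gamma> * card H"
proof
  let ?K = "{h \<otimes> s [^] (r :: int) | h r. h \<in> H}"
  interpret H: subgroup H G by (rule H)
  show "subgroup ?K G"
  proof
    show "?K \<subseteq> carrier G" using s H.subset by auto
    have "\<one> = \<one> \<otimes> s [^] (0 :: int)" by simp
    then show "\<one> \<in> ?K" using H.one_closed by blast
  next
    fix x y assume "x \<in> ?K" "y \<in> ?K"
    then obtain h r h' r' where *: "h \<in> H" "h' \<in> H" "x = h \<otimes> s [^] (r :: int)" "y = h' \<otimes> s [^] (r' :: int)"
      by auto
    then have "x \<otimes> y = (h \<otimes> h') \<otimes> s [^] (r + r')"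
      using s H.subset by (simp add: int_pow_mult m_ac subset_iff)
    then show "x \<otimes> y \<in> ?K" using * H.m_closed by blast
  next
    fix x assume "x \<in> ?K"
    then obtain h r where *: "h \<in> H" "x = h \<otimes> s [^] (r :: int)" by auto
    then have "inv x = inv h \<otimes> s [^] (- r)"
      using s H.subset by (simp add: int_pow_neg inv_mult subset_iff)
    then show "inv x \<in> ?K" using * H.m_inv_closed by blast
  qed
  show "H \<subseteq> ?K"
  proof
    fix h assume "h \<in> H"
    moreover from this have "h = h \<otimes> s [^] (0 :: int)" using H.subset by auto
    ultimately show "h \<in> ?K" by blast
  qed
  have "s = \<one> \<otimes> s [^] (1 :: int)" using s by simp
  then show "s \<in> ?K" using H.one_closed by blast
  have "?K \<subseteq> (\<lambda>(h, r). h \<otimes> s [^] r) ` (H \<times> {..<\<gamma>})"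
  proof clarify
    fix h and r :: int assume h: "h \<in> H"
    define q r' where "q = r div int \<gamma>" and "r' = nat (r mod int \<gamma>)"
    have r: "r = q * int \<gamma> + int r'" and "r' < \<gamma>"
      using \<open>\<gamma> > 0\<close> by (simp_all add: q_def r'_def nat_less_iff)
    have "h \<otimes> s [^] r = h \<otimes> (s [^] (q * int \<gamma>) \<otimes> s [^] int r')"
      unfolding r using s by (simp only: int_pow_mult)
    also have "\<dots> = (h \<otimes> (s [^] q) [^] \<gamma>) \<otimes> s [^] r'"
      using s h H.subset int_pow_pow[OF s, of q "int \<gamma>"] by (simp add: m_assoc int_pow_int subset_iff)
    finally have "h \<otimes> s [^] r = (h \<otimes> (s [^] q) [^] \<gamma>) \<otimes> s [^] r'" .
    moreover have "h \<otimes> (s [^] q) [^] \<gamma> \<in> H" using h pow s by simp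
    ultimately show "h \<otimes> s [^] r \<in> (\<lambda>(h, r). h \<otimes> s [^] r) ` (H \<times> {..<\<gamma>})"
      using \<open>r' < \<gamma>\<close> by (intro image_eqI[of _ _ "(h \<otimes> (s [^] q) [^] \<gamma>, r')"]) auto
  qed
  moreover have "finite H" using fin H.subset finite_subset by blast
  ultimately have "card ?K \<le> card (H \<times> {..<\<gamma>})"
    by (intro surj_card_le) auto
  then show "card ?K \<le> \<gamma> * card H" by (simp add: card_cartesian_product mult.commute)
qed

text \<open>Bounds the index of the subgroup of \<open>\<gamma>\<close>-th powers: starting from
  that subgroup, the generators are adjoined one at a time, and each multiplies the order by at most
  \<open>\<gamma>\<close>.\<close>

lemma (in comm_group) card_le_pow_image:
  assumes fin: "finite (carrier G)" and S: "S \<subseteq> carrier G" "finite S" "generate G S = carrier G"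
    and \<gamma>: "\<gamma> > 0"
  shows "card (carrier G) \<le> \<gamma> ^ card S * card ((\<lambda>x. x [^] \<gamma>) ` carrier G)"
proof -
  let ?M = "(\<lambda>x. x [^] \<gamma>) ` carrier G"
  have "\<exists>H. subgroup H G \<and> S \<union> ?M \<subseteq> H \<and> card H \<le> \<gamma> ^ card S * card ?M"
    using \<open>finite S\<close> S(1)
  proof (induction S)
    case empty
    then show ?case using subgroup_pow_image by (intro exI[of _ ?M]) auto
  next
    case (insert s S)
    then obtain H where H: "subgroup H G" "S \<union> ?M \<subseteq> H" "card H \<le> \<gamma> ^ card S * card ?M" by auto
    obtain K where K: "subgroup K G" "H \<subseteq> K" "s \<in> K" "card K \<le> \<gamma> * card H"
      by (rule subgroup_adjoin[OF fin H(1), of s \<gamma>]) (use insert.prems H(2) \<gamma> in auto)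
    have "card K \<le> \<gamma> * (\<gamma> ^ card S * card ?M)"
      using K(4) H(3) by (meson mult_le_mono2 order_trans)
    then show ?case using K H(2) insert.hyps by (intro exI[of _ K]) auto
  qed
  then obtain H where H: "subgroup H G" "S \<subseteq> H" "card H \<le> \<gamma> ^ card S * card ?M" by auto
  then have "carrier G \<subseteq> H" using generate_subgroup_incl S(3) by metis
  then have "H = carrier G" using subgroup.subset[OF H(1)] by auto
  with H(3) show ?thesis by simp
qed

text \<open>Take the largest \<open>n\<close> such that some \<open>n\<close> elements generate a
  subgroup of order at least \<open>2 ^ n\<close>. If that subgroup were proper, adjoining an
  outside element would add a disjoint coset and double the order, contradicting maximality.\<close>

lemma (in group) small_generating_set:
  assumes fin: "finite (carrier G)"
  shows "\<exists>S. S \<subseteq> carrier G \<and> finite S \<and> generate G S = carrier G \<and> 2 ^ card S \<le> card (carrier G)"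
proof -
  define P where "P n = (\<exists>S. S \<subseteq> carrier G \<and> finite S \<and> card S = n \<and> 2 ^ n \<le> card (generate G S))" for n
  have gen_sub: "generate G S \<subseteq> carrier G" if "S \<subseteq> carrier G" for S
    using generate_incl[OF that] .
  have gen_fin: "finite (generate G S)" if "S \<subseteq> carrier G" for S
    by (rule finite_subset[OF gen_sub[OF that] fin])
  have bound: "n \<le> card (carrier G)" if "P n" for n
  proof -
    from that obtain S where S: "S \<subseteq> carrier G" "2 ^ n \<le> card (generate G S)"
      unfolding P_def by blast
    then have "2 ^ n \<le> card (carrier G)"
      using card_mono[OF fin gen_sub[OF S(1)]] by linarith
    then show ?thesis using less_exp[of n] by linarith
  qed
  have "P 0" unfolding P_def by (intro exI[of _ "{}"]) (simp add: generate_empty)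
  then have PG: "P (Greatest P)" by (rule GreatestI_nat) (rule bound)
  have max: "n \<le> Greatest P" if "P n" for n using that by (rule Greatest_le_nat) (rule bound)
  obtain m where m: "m = Greatest P" by simp
  obtain S where S: "S \<subseteq> carrier G" "finite S" "card S = m" "2 ^ m \<le> card (generate G S)"
    using PG unfolding m[symmetric] P_def by blast
  have "generate G S = carrier G"
  proof (rule ccontr)
    assume "generate G S \<noteq> carrier G"
    then obtain x where x: "x \<in> carrier G" "x \<notin> generate G S" using gen_sub[OF S(1)] by auto
    let ?K = "generate G (insert x S)" and ?H = "generate G S"
    have xS: "insert x S \<subseteq> carrier G" using x S by auto
    interpret H: subgroup ?H G by (rule generate_is_subgroup[OF S(1)])
    interpret K: subgroup ?K G by (rule generate_is_subgroup[OF xS])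
    have HK: "?H \<subseteq> ?K" by (rule mono_generate) auto
    have xK: "x \<in> ?K" by (rule generate.incl) simp
    have "x \<otimes> h \<notin> ?H" if "h \<in> ?H" for h
    proof
      assume "x \<otimes> h \<in> ?H"
      then have "x \<otimes> h \<otimes> inv h \<in> ?H" using that by simp
      then show False using x that H.subset by (simp add: m_assoc subset_iff)
    qed
    then have "?H \<inter> (\<lambda>h. x \<otimes> h) ` ?H = {}" by auto
    moreover have "card ((\<lambda>h. x \<otimes> h) ` ?H) = card ?H"
      using x H.subset by (intro card_image inj_onI) (auto simp: subset_iff)
    ultimately have "card (?H \<union> (\<lambda>h. x \<otimes> h) ` ?H) = 2 * card ?H"
      using gen_fin[OF S(1)] by (simp add: card_Un_disjoint)
    moreover have "?H \<union> (\<lambda>h. x \<otimes> h) ` ?H \<subseteq> ?K" using HK xK by auto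
    ultimately have "2 * card ?H \<le> card ?K" using card_mono[OF gen_fin[OF xS]] by metis
    moreover have "x \<notin> S" using x generate.incl by metis
    ultimately have "P (Suc (card S))"
      unfolding P_def using S xS by (intro exI[of _ "insert x S"]) simp
    then show False using max[of "Suc (card S)"] S(3) m by simp
  qed
  moreover have "2 ^ card S \<le> card (carrier G)"
    using S(3,4) card_mono[OF fin gen_sub[OF S(1)]] by simp
  ultimately show ?thesis using S(1,2) by blast
qed

lemma min_gen_size_properties:
  assumes "group A" and fin: "finite (carrier A)"
  shows "\<exists>S. S \<subseteq> carrier A \<and> finite S \<and> card S = min_gen_size A \<and> generate A S = carrier A"
    and "2 ^ min_gen_size A \<le> card (carrier A)"
proof -
  obtain S where S: "S \<subseteq> carrier A" "finite S" "generate A S = carrier A" "2 ^ card S \<le> card (carrier A)"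
    using group.small_generating_set[OF assms] by auto
  let ?P = "\<lambda>n. \<exists>S. S \<subseteq> carrier A \<and> finite S \<and> card S = n \<and> generate A S = carrier A"
  have P: "?P (card S)" using S by blast
  show "?P (min_gen_size A)" unfolding min_gen_size_def using LeastI[of ?P, OF P] by simp
  have "min_gen_size A \<le> card S" unfolding min_gen_size_def using Least_le[of ?P, OF P] .
  then have "(2::nat) ^ min_gen_size A \<le> 2 ^ card S" by simp
  with S(4) show "2 ^ min_gen_size A \<le> card (carrier A)" by linarith
qed

section \<open>The direct sum of the lower central factors\<close>

context
  fixes G :: "('a, 'b) monoid_scheme" (structure)
  assumes nilpotent: "nilpotent_group G" and fin: "finite (carrier G)"
begin

interpretation group G
  using nilpotent by (simp add: nilpotent_group_def)

abbreviation (input) factor :: "nat \<Rightarrow> 'a set monoid" where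
  "factor l \<equiv> (G\<lparr>carrier := lower_central G (l - 1)\<rparr>) Mod lower_central G l"

lemma factor_eq: "l \<in> {1..L} \<Longrightarrow> factor l = group.layer G (l - 1)"
  by (simp add: layer_def)

lemma group_factor: "l \<in> {1..L} \<Longrightarrow> group (factor l)"
  using group_layer[of "l - 1"] factor_eq[of l L] by simp

lemma finite_layer: "finite (carrier (group.layer G l))"
  unfolding carrier_layer by (intro finite_imageI finite_subset[OF lower_central_subset fin])

lemma carrier_lower_central_sum:
  "carrier (lower_central_sum G) = (\<Pi>\<^sub>E l\<in>{1..nilpotency_class G}. carrier (group.layer G (l - 1)))"
proof -
  have "carrier (lower_central_sum G) = (\<Pi>\<^sub>E l\<in>{1..nilpotency_class G}. carrier (factor l))"
  proof -
    have "carrier (sum_group {1..nilpotency_class G} factor)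
        = {x \<in> \<Pi>\<^sub>E l\<in>{1..nilpotency_class G}. carrier (factor l). finite {l \<in> {1..nilpotency_class G}. x l \<noteq> \<one>\<^bsub>factor l\<^esub>}}"
      by (rule carrier_sum_group) (rule group_factor)
    then show ?thesis unfolding lower_central_sum_def by simp
  qed
  also have "\<dots> = (\<Pi>\<^sub>E l\<in>{1..nilpotency_class G}. carrier (group.layer G (l - 1)))"
    by (intro PiE_cong) (metis factor_eq)
  finally show ?thesis .
qed

lemma prod_shift: "(\<Prod>l\<in>{1..L}. h (l - 1)) = (\<Prod>l<L. h (l::nat) :: nat)"
  by (rule prod.reindex_bij_witness[of _ Suc "\<lambda>l. l - 1"]) auto

lemma lower_central_class: "lower_central G (nilpotency_class G) = {\<one>}"
proof -
  obtain l where "lower_central G l = {\<one>}" using nilpotent unfolding nilpotent_group_def by blast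
  then show ?thesis unfolding nilpotency_class_def by (rule LeastI)
qed

text \<open>The orders of the factors telescope along the series, from the whole group down to the
  trivial subgroup.\<close>

lemma card_lower_central_sum: "card (carrier (lower_central_sum G)) = card (carrier G)"
proof -
  have "card (carrier (lower_central_sum G)) = (\<Prod>l<nilpotency_class G. card (carrier (group.layer G l)))"
    unfolding carrier_lower_central_sum
    using prod_shift[of "\<lambda>l. card (carrier (group.layer G l))"] by (simp add: card_PiE)
  then show ?thesis
    using prod_card_layers[OF fin, of "nilpotency_class G"] by (simp add: lower_central_class)
qed

lemma finite_lower_central_sum: "finite (carrier (lower_central_sum G))"
  unfolding carrier_lower_central_sum using finite_layer by (intro finite_PiE) auto

lemma group_lower_central_sum: "group (lower_central_sum G)"
  unfolding lower_central_sum_def by (rule sum_group) (rule group_factor)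

lemma comm_group_lower_central_sum: "comm_group (lower_central_sum G)"
proof (rule group.group_comm_groupI[OF group_lower_central_sum])
  fix x y assume x: "x \<in> carrier (lower_central_sum G)" and y: "y \<in> carrier (lower_central_sum G)"
  have "x l \<otimes>\<^bsub>factor l\<^esub> y l = y l \<otimes>\<^bsub>factor l\<^esub> x l" if l: "l \<in> {1..nilpotency_class G}" for l
    unfolding factor_eq[OF l] using x y l
    by (intro comm_monoid.m_comm comm_group.axioms(1) comm_group_layer) (auto simp: carrier_lower_central_sum)
  then show "x \<otimes>\<^bsub>lower_central_sum G\<^esub> y = y \<otimes>\<^bsub>lower_central_sum G\<^esub> x"
    unfolding lower_central_sum_def mult_sum_group by (intro restrict_ext) auto
qed

lemma pow_lower_central_sum:
  assumes "l \<in> {1..nilpotency_class G}"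
  shows "(x [^]\<^bsub>lower_central_sum G\<^esub> (n :: nat)) l = x l [^]\<^bsub>group.layer G (l - 1)\<^esub> n"
proof (induction n)
  case 0
  have "(\<one>\<^bsub>lower_central_sum G\<^esub>) l = \<one>\<^bsub>group.layer G (l - 1)\<^esub>"
    unfolding lower_central_sum_def one_sum_group using assms by (simp only: restrict_apply' factor_eq[OF assms])
  then show ?case
    by (simp only: monoid.nat_pow_0 group.is_monoid group_layer group_lower_central_sum)
next
  case (Suc n)
  have "(y \<otimes>\<^bsub>lower_central_sum G\<^esub> x) l = y l \<otimes>\<^bsub>group.layer G (l - 1)\<^esub> x l" for y
    unfolding lower_central_sum_def mult_sum_group using assms by (simp only: restrict_apply' factor_eq[OF assms])
  with Suc show ?case
    by (simp only: monoid.nat_pow_Suc group.is_monoid group_layer group_lower_central_sum)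
qed

lemma card_pow_lower_central_sum:
  "card ((\<lambda>x. x [^]\<^bsub>lower_central_sum G\<^esub> (\<gamma>::nat)) ` carrier (lower_central_sum G))
    \<le> (\<Prod>l<nilpotency_class G. card ((\<lambda>x. x [^]\<^bsub>group.layer G l\<^esub> \<gamma>) ` carrier (group.layer G l)))"
proof -
  let ?r = "\<lambda>l. (\<lambda>x. x [^]\<^bsub>group.layer G l\<^esub> \<gamma>) ` carrier (group.layer G l)"
  interpret S: group "lower_central_sum G" by (rule group_lower_central_sum)
  have "(\<lambda>x. x [^]\<^bsub>lower_central_sum G\<^esub> \<gamma>) ` carrier (lower_central_sum G)
      \<subseteq> (\<Pi>\<^sub>E l\<in>{1..nilpotency_class G}. ?r (l - 1))"
  proof clarify
    fix x assume x: "x \<in> carrier (lower_central_sum G)"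
    then have "x [^]\<^bsub>lower_central_sum G\<^esub> \<gamma> \<in> carrier (lower_central_sum G)" by simp
    then have "x [^]\<^bsub>lower_central_sum G\<^esub> \<gamma> \<in> extensional {1..nilpotency_class G}"
      unfolding carrier_lower_central_sum PiE_iff by blast
    moreover have "(x [^]\<^bsub>lower_central_sum G\<^esub> \<gamma>) l \<in> ?r (l - 1)" if "l \<in> {1..nilpotency_class G}" for l
      using x that unfolding pow_lower_central_sum[OF that] carrier_lower_central_sum by blast
    ultimately show "x [^]\<^bsub>lower_central_sum G\<^esub> \<gamma> \<in> (\<Pi>\<^sub>E l\<in>{1..nilpotency_class G}. ?r (l - 1))"
      unfolding PiE_iff by blast
  qed
  then have "card ((\<lambda>x. x [^]\<^bsub>lower_central_sum G\<^esub> \<gamma>) ` carrier (lower_central_sum G))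
      \<le> card (\<Pi>\<^sub>E l\<in>{1..nilpotency_class G}. ?r (l - 1))"
    using finite_layer by (intro card_mono finite_PiE) auto
  also have "\<dots> = (\<Prod>l<nilpotency_class G. card (?r l))"
    using prod_shift[of "\<lambda>l. card (?r l)"] by (simp add: card_PiE)
  finally show ?thesis .
qed

lemma min_gen_size_log: "2 ^ min_gen_size (lower_central_sum G) \<le> card (carrier G)"
  using min_gen_size_properties(2)[OF group_lower_central_sum finite_lower_central_sum]
  by (simp only: card_lower_central_sum)

text \<open>At the last term of the series the layer-wise count concerns tuples at which the word is
  trivial. The product of the numbers of \<open>\<gamma>\<close>-th powers in the layers is bounded
  below through the index bound for the direct sum, and this is how its number of generators
  enters.\<close>

lemma card_trivial_word:
  assumes w: "\<And>i e. (i, e) \<in> set w \<Longrightarrow> i < k"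
    and u: "(\<Sum>(i, e)\<leftarrow>w. u i * e) = int \<gamma>" and "\<gamma> > 0"
  shows "card {zs. set zs \<subseteq> carrier G \<and> length zs = k \<and> word_eval G ((!) zs) w = \<one>} * card (carrier G)
    \<le> \<gamma> ^ min_gen_size (lower_central_sum G) * card (carrier G) ^ k"
proof -
  let ?S = "lower_central_sum G" and ?L = "nilpotency_class G"
  let ?d = "min_gen_size (lower_central_sum G)"
  let ?p = "\<Prod>l<?L. card ((\<lambda>x. x [^]\<^bsub>group.layer G l\<^esub> \<gamma>) ` carrier (group.layer G l))"
  let ?X = "{zs. set zs \<subseteq> carrier G \<and> length zs = k \<and> word_eval G ((!) zs) w = \<one>}"
  obtain S where "S \<subseteq> carrier ?S" "finite S" "card S = ?d" "generate ?S S = carrier ?S"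
    using min_gen_size_properties(1)[OF group_lower_central_sum finite_lower_central_sum] by blast
  then have "card (carrier G) \<le> \<gamma> ^ ?d * card ((\<lambda>x. x [^]\<^bsub>?S\<^esub> \<gamma>) ` carrier ?S)"
    using comm_group.card_le_pow_image[OF comm_group_lower_central_sum finite_lower_central_sum, of S \<gamma>] \<open>\<gamma> > 0\<close>
    by (simp only: card_lower_central_sum)
  also have "\<dots> \<le> \<gamma> ^ ?d * ?p"
    by (intro mult_left_mono card_pow_lower_central_sum) simp
  finally have "card ?X * card (carrier G) \<le> card ?X * (\<gamma> ^ ?d * ?p)"
    by (rule mult_le_mono2)
  also have "\<dots> = \<gamma> ^ ?d * (card ?X * ?p)" by (rule mult.left_commute)
  also have "?X = group.generators_into G k w ?L"
    by (simp add: generators_into_def lower_central_class)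
  also have "\<gamma> ^ ?d * (card \<dots> * ?p) \<le> \<gamma> ^ ?d * card (carrier G) ^ k"
    by (intro mult_left_mono card_generators_into[OF fin w u]) auto
  finally show ?thesis by (simp add: generators_into_def lower_central_class)
qed

end

subsection \<open>Divisibility of the exponent sums of a random word\<close>

text \<open>Supplies the exponents \<open>u\<close> of the substitution along the series.\<close>

lemma bezout_finite_int:
  fixes v :: "'i \<Rightarrow> int"
  assumes "finite A"
  shows "\<exists>u. (\<Sum>i\<in>A. u i * v i) = Gcd (v ` A)"
  using assms
proof (induction A)
  case (insert j A)
  then obtain u where u: "(\<Sum>i\<in>A. u i * v i) = Gcd (v ` A)" by auto
  obtain p q where pq: "p * v j + q * Gcd (v ` A) = gcd (v j) (Gcd (v ` A))"
    using bezout_int by blast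
  have "(\<Sum>i\<in>insert j A. (if i = j then p else q * u i) * v i) = p * v j + (\<Sum>i\<in>A. q * u i * v i)"
    using insert.hyps by (simp add: sum.insert) (rule sum.cong, auto)
  also have "\<dots> = Gcd (v ` insert j A)"
    using pq by (simp add: u[symmetric] sum_distrib_left mult.assoc)
  finally show ?case by (intro exI[of _ "\<lambda>i. if i = j then p else q * u i"])
qed auto

lemma sum_prod_list:
  fixes g :: "'t \<Rightarrow> 'v::comm_semiring_1"
  shows "(\<Sum>w | set w \<subseteq> T \<and> length w = n. prod_list (map g w)) = (\<Sum>t\<in>T. g t) ^ n"
proof (induction n)
  case 0
  have "{w. set w \<subseteq> T \<and> length w = 0} = {[]}" by auto
  then show ?case by simp
next
  case (Suc n)
  then show ?case by (simp add: sum_lists_Suc sum_distrib_right flip: sum_distrib_left)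
qed

definition steps :: "nat \<Rightarrow> (nat \<times> bool \<times> bool) set" where
  "steps k = {..<k} \<times> UNIV"

text \<open>The difference of two bits: swapping them inverts the step, and half of the steps are
  lazy. The Fourier transform is a squared cosine, whose nonnegativity allows bounds on it to be
  raised to powers.\<close>

definition step_exp :: "bool \<times> bool \<Rightarrow> int" where
  "step_exp = (\<lambda>(a, b). of_bool a - of_bool b)"

definition exponent_sum :: "(nat \<times> bool \<times> bool) list \<Rightarrow> nat \<Rightarrow> int" where
  "exponent_sum w i = (\<Sum>(j, s)\<leftarrow>w. if j = i then step_exp s else 0)"

lemma finite_steps: "finite (steps k)"
  by (simp add: steps_def)

lemma card_steps: "card (steps k) = 4 * k"
  by (simp add: steps_def card_cartesian_product card_UNIV_bool flip: UNIV_Times_UNIV)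

lemma sum_steps: "(\<Sum>t\<in>steps k. h t) =
    (\<Sum>i<k. h (i, True, True) + h (i, True, False) + h (i, False, True) + h (i, False, False))"
  for h :: "_ \<Rightarrow> 'v::comm_monoid_add"
proof -
  have "(\<Sum>t\<in>steps k. h t) = (\<Sum>i<k. \<Sum>s\<in>UNIV. h (i, s))"
    by (simp add: steps_def sum.cartesian_product)
  also have "\<dots> = (\<Sum>i<k. \<Sum>a\<in>UNIV. \<Sum>b\<in>UNIV. h (i, a, b))"
    by (simp add: sum.cartesian_product flip: UNIV_Times_UNIV)
  finally show ?thesis by (simp add: UNIV_bool add_ac)
qed

lemma abs_exponent_sum_le: "\<bar>exponent_sum w i\<bar> \<le> int (length w)"
proof (induction w)
  case (Cons p w)
  obtain j a b where "p = (j, a, b)" by (cases p) auto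
  then show ?case using Cons by (auto simp: exponent_sum_def step_exp_def)
qed (simp add: exponent_sum_def)

lemma sum_exponents:
  assumes "set w \<subseteq> steps k"
  shows "(\<Sum>(i, e)\<leftarrow>map (\<lambda>(i, s). (i, step_exp s)) w. u i * e) = (\<Sum>i<k. u i * exponent_sum w i)"
  using assms
proof (induction w)
  case (Cons p w)
  obtain j s where p: "p = (j, s)" and j: "j < k" using Cons.prems by (auto simp: steps_def)
  have "(\<Sum>i<k. u i * exponent_sum (p # w) i)
      = (\<Sum>i<k. if i = j then u i * step_exp s else 0) + (\<Sum>i<k. u i * exponent_sum w i)"
    unfolding sum.distrib[symmetric] by (intro sum.cong) (auto simp: p exponent_sum_def algebra_simps)
  then show ?case using Cons j by (simp add: p)
qed (simp add: exponent_sum_def)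

section \<open>Fourier analysis modulo \<open>\<gamma>\<close>, beginning with the orthogonality of
  characters\<close>

lemma sum_cis_multiples:
  fixes x :: int
  assumes "\<gamma> > 0"
  shows "(\<Sum>\<theta><\<gamma>. cis (2 * pi * real \<theta> * x / real \<gamma>)) = (if int \<gamma> dvd x then of_nat \<gamma> else 0)"
proof -
  let ?z = "cis (2 * pi * x / real \<gamma>)"
  have pow: "cis (2 * pi * real \<theta> * x / real \<gamma>) = ?z ^ \<theta>" for \<theta>
    by (simp add: Complex.DeMoivre mult_ac)
  show ?thesis
  proof (cases "int \<gamma> dvd x")
    case True
    then obtain y where "x = int \<gamma> * y" by auto
    then have "2 * pi * x / real \<gamma> = 2 * pi * of_int y" using assms by simp
    moreover have "cis (2 * pi * of_int y) = 1" by (rule cis_multiple_2pi) auto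
    ultimately have "?z = 1" by (simp only:)
    then show ?thesis using True by (simp add: pow)
  next
    case False
    have "?z \<noteq> 1"
    proof
      assume "?z = 1"
      then have "cos (2 * pi * x / real \<gamma>) = 1" by (simp add: complex_eq_iff)
      then obtain y :: int where "2 * pi * x / real \<gamma> = of_int y * 2 * pi"
        using cos_one_2pi_int by blast
      then have "real_of_int x = of_int (y * int \<gamma>)" using assms by (simp add: field_simps)
      then have "x = y * int \<gamma>" by (simp only: of_int_eq_iff)
      with False show False by simp
    qed
    moreover have "?z ^ \<gamma> = 1"
    proof -
      have "real \<gamma> * (2 * pi * x / real \<gamma>) = 2 * pi * of_int x" using assms by simp
      then have "?z ^ \<gamma> = cis (2 * pi * of_int x)" by (simp only: Complex.DeMoivre)
      also have "\<dots> = 1" by (rule cis_multiple_2pi) auto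
      finally show ?thesis .
    qed
    ultimately show ?thesis using False by (simp add: pow geometric_sum)
  qed
qed

text \<open>An average over the characters modulo \<open>\<gamma>\<close>: the factor that each of
  the \<open>k\<close> coordinates contributes to the bound on the probability that all exponent
  sums of a word of length \<open>C * k\<close> are divisible by \<open>\<gamma>\<close>.\<close>

definition gauss_average :: "real \<Rightarrow> nat \<Rightarrow> real" where
  "gauss_average C \<gamma> = (\<Sum>\<theta><\<gamma>. exp (- C * (sin (pi * real \<theta> / real \<gamma>))\<^sup>2)) / real \<gamma>"

text \<open>Regrouping a character letter by letter lets the sum over all words collapse to a power
  of a sum over single steps.\<close>

lemma prod_cis_exponents:
  assumes "set w \<subseteq> steps k"
  shows "(\<Prod>i<k. cis (2 * pi * real (\<theta> i) * exponent_sum w i / real \<gamma>))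
    = prod_list (map (\<lambda>(i, s). cis (2 * pi * real (\<theta> i) * step_exp s / real \<gamma>)) w)"
  using assms
proof (induction w)
  case Nil
  then show ?case by (simp add: exponent_sum_def)
next
  case (Cons p w)
  obtain j s where p: "p = (j, s)" and j: "j < k" using Cons.prems by (auto simp: steps_def)
  have "(\<Prod>i<k. cis (2 * pi * real (\<theta> i) * exponent_sum (p # w) i / real \<gamma>))
      = (\<Prod>i<k. (if i = j then cis (2 * pi * real (\<theta> j) * step_exp s / real \<gamma>) else 1)
          * cis (2 * pi * real (\<theta> i) * exponent_sum w i / real \<gamma>))"
    by (intro prod.cong) (auto simp: p exponent_sum_def cis_mult ring_distribs add_divide_distrib)
  also have "\<dots> = cis (2 * pi * real (\<theta> j) * step_exp s / real \<gamma>)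
      * (\<Prod>i<k. cis (2 * pi * real (\<theta> i) * exponent_sum w i / real \<gamma>))"
    using j by (simp add: prod.distrib)
  finally show ?case using Cons p by simp
qed

lemma sum_cis_steps:
  "(\<Sum>(i, s)\<in>steps k. cis (2 * pi * real (\<theta> i) * step_exp s / real \<gamma>))
    = of_real (\<Sum>i<k. 4 * (cos (pi * real (\<theta> i) / real \<gamma>))\<^sup>2)"
proof -
  have "2 + cis (2 * x) + cis (- (2 * x)) = of_real (4 * (cos x)\<^sup>2)" for x :: real
    by (simp add: complex_eq_iff cos_double_cos)
  from this[of "pi * real (\<theta> i) / real \<gamma>" for i] show ?thesis
    unfolding sum_steps of_real_sum by (intro sum.cong) (auto simp: step_exp_def add_ac mult_ac)
qed

text \<open>Orthogonality writes the divisibility condition as an average over frequency vectors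
  \<open>\<theta>\<close>, one entry per generator. For fixed \<open>\<theta>\<close> the sum over
  words is a power of a single-step transform, and an exponential bound on it factors over the
  coordinates.\<close>

lemma card_words_dvd:
  assumes "k > 0" "\<gamma> > 0"
  shows "real (card {w. set w \<subseteq> steps k \<and> length w = C * k \<and> (\<forall>i<k. int \<gamma> dvd exponent_sum w i)})
    \<le> (4 * real k) ^ (C * k) * gauss_average C \<gamma> ^ k"
proof -
  let ?n = "C * k" and ?D = "{w. set w \<subseteq> steps k \<and> length w = C * k \<and> (\<forall>i<k. int \<gamma> dvd exponent_sum w i)}"
  let ?\<Theta> = "PiE {..<k} (\<lambda>_. {..<\<gamma>})"
  let ?s = "\<lambda>\<theta> i. (sin (pi * real (\<theta> i) / real \<gamma>))\<^sup>2"
  have fin: "finite {w. set w \<subseteq> steps k \<and> length w = C * k}"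
    by (rule finite_lists_length_eq[OF finite_steps])
  have ind: "(\<Prod>i<k. \<Sum>x<\<gamma>. cis (2 * pi * real x * exponent_sum w i / real \<gamma>))
      = (if \<forall>i<k. int \<gamma> dvd exponent_sum w i then of_nat \<gamma> ^ k else 0)" for w
    using assms by (auto simp: sum_cis_multiples)
  have "complex_of_real (real \<gamma> ^ k * card ?D)
      = (\<Sum>w | set w \<subseteq> steps k \<and> length w = ?n. if \<forall>i<k. int \<gamma> dvd exponent_sum w i then of_nat \<gamma> ^ k else 0)"
    using fin by (simp add: sum.If_cases Int_def conj_assoc mult.commute)
  also have "\<dots> = (\<Sum>w | set w \<subseteq> steps k \<and> length w = ?n. \<Sum>\<theta>\<in>?\<Theta>.
      \<Prod>i<k. cis (2 * pi * real (\<theta> i) * exponent_sum w i / real \<gamma>))"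
    unfolding ind[symmetric] by (intro sum.cong refl prod_sum_PiE) auto
  also have "\<dots> = (\<Sum>\<theta>\<in>?\<Theta>. \<Sum>w | set w \<subseteq> steps k \<and> length w = ?n.
      prod_list (map (\<lambda>(i, s). cis (2 * pi * real (\<theta> i) * step_exp s / real \<gamma>)) w))"
    by (subst sum.swap) (intro sum.cong refl, auto simp: prod_cis_exponents)
  also have "\<dots> = complex_of_real (\<Sum>\<theta>\<in>?\<Theta>. (\<Sum>i<k. 4 * (cos (pi * real (\<theta> i) / real \<gamma>))\<^sup>2) ^ ?n)"
    unfolding sum_prod_list sum_cis_steps by simp
  finally have "real \<gamma> ^ k * card ?D = (\<Sum>\<theta>\<in>?\<Theta>. (\<Sum>i<k. 4 * (cos (pi * real (\<theta> i) / real \<gamma>))\<^sup>2) ^ ?n)"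
    by (simp only: of_real_eq_iff)
  also have "\<dots> \<le> (\<Sum>\<theta>\<in>?\<Theta>. (4 * real k) ^ ?n * (\<Prod>i<k. exp (- real C * ?s \<theta> i)))"
  proof (rule sum_mono)
    fix \<theta> :: "nat \<Rightarrow> nat"
    let ?S = "\<Sum>i<k. ?s \<theta> i"
    have "(\<Sum>i<k. 4 * (cos (pi * real (\<theta> i) / real \<gamma>))\<^sup>2) = 4 * (real k - ?S)"
      by (simp add: cos_squared_eq sum_subtractf flip: sum_distrib_left)
    also have "\<dots> = 4 * real k * (1 - ?S / real k)"
      using assms by (simp add: field_simps)
    \<comment> \<open>The exponential decouples the coordinates: its power \<open>C * k\<close>
      cancels the denominator \<open>k\<close> and becomes a product with weight \<open>C\<close> in
      each coordinate.\<close>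
    also have "\<dots> \<le> 4 * real k * exp (- (?S / real k))"
      by (intro mult_left_mono exp_minus_ge) auto
    finally have "(\<Sum>i<k. 4 * (cos (pi * real (\<theta> i) / real \<gamma>))\<^sup>2) ^ ?n \<le> (4 * real k * exp (- (?S / real k))) ^ ?n"
      by (intro power_mono) (auto intro!: sum_nonneg)
    also have "\<dots> = (4 * real k) ^ ?n * exp (real ?n * (- (?S / real k)))"
      by (simp only: power_mult_distrib exp_of_nat_mult)
    also have "real ?n * (- (?S / real k)) = (\<Sum>i<k. - real C * ?s \<theta> i)"
      using assms by (simp add: sum_negf flip: sum_distrib_left)
    finally show "(\<Sum>i<k. 4 * (cos (pi * real (\<theta> i) / real \<gamma>))\<^sup>2) ^ ?n
        \<le> (4 * real k) ^ ?n * (\<Prod>i<k. exp (- real C * ?s \<theta> i))"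
      by (simp add: exp_sum)
  qed
  also have "\<dots> = (4 * real k) ^ ?n * (\<Prod>i<k. \<Sum>x<\<gamma>. exp (- real C * (sin (pi * real x / real \<gamma>))\<^sup>2))"
    by (subst prod_sum_PiE) (auto simp: sum_distrib_left)
  also have "\<dots> = real \<gamma> ^ k * ((4 * real k) ^ ?n * gauss_average C \<gamma> ^ k)"
    using assms by (simp add: gauss_average_def power_divide)
  finally show ?thesis using assms by simp
qed

section \<open>Jordan's inequality for the sine and the size of \<open>gauss_average\<close>\<close>

lemma sin_ge_linear:
  assumes "0 \<le> t" "t \<le> 1"
  shows "t \<le> sin (t * (pi / 2))"
proof -
  have "concave_on {0..pi / 2} (sin :: real \<Rightarrow> real)"
    by (rule f''_le0_imp_concave[where f' = cos and f'' = "\<lambda>x. - sin x"])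
       (auto intro!: derivative_eq_intros sin_ge_zero)
  from concave_onD_Icc[OF this, of t] assms show ?thesis by simp
qed

text \<open>A frequency is bad if \<open>\<theta> / \<gamma>\<close> is closer than
  \<open>1 / M\<close> to 0 or 1. Any other frequency has sine at least \<open>2 / M\<close> by
  Jordan's inequality and contributes at most the exponential term. For
  \<open>\<gamma> \<le> M\<close> only \<open>\<theta> = 0\<close> is bad; for larger
  \<open>\<gamma>\<close> there are at most \<open>2 * \<gamma> / M + 1\<close> bad frequencies, and
  the 1 is absorbed into a third \<open>\<gamma> / M\<close>.\<close>

lemma gauss_average_le:
  fixes C :: real
  assumes "M \<ge> 2" "\<gamma> > 0" "C \<ge> 0"
  shows "gauss_average C \<gamma> \<le> (if \<gamma> \<le> M then 1 / real \<gamma> else 3 / real M) + exp (- 4 * C / (real M)\<^sup>2)"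
proof -
  define B where "B = {\<theta>. \<theta> < \<gamma> \<and> (M * \<theta> < \<gamma> \<or> M * (\<gamma> - \<theta>) < \<gamma>)}"
  let ?f = "\<lambda>\<theta>. exp (- C * (sin (pi * real \<theta> / real \<gamma>))\<^sup>2)" and ?e = "exp (- 4 * C / (real M)\<^sup>2)"
  have "?f \<theta> \<le> (if \<theta> \<in> B then 1 else 0) + ?e" if \<theta>: "\<theta> < \<gamma>" for \<theta>
  proof (cases "\<theta> \<in> B")
    case True
    have "?f \<theta> \<le> 1" using assms by simp
    then show ?thesis using True by (simp add: add_increasing2)
  next
    case False
    then have *: "\<gamma> \<le> M * \<theta>" "\<gamma> \<le> M * (\<gamma> - \<theta>)" using \<theta> by (auto simp: B_def)
    have lin: "2 / real M \<le> 2 * b / real \<gamma>" if "real \<gamma> \<le> real M * b" for b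
      using that assms by (simp add: field_simps)
    have "2 / real M \<le> sin (pi * real \<theta> / real \<gamma>)"
    proof (cases "2 * \<theta> \<le> \<gamma>")
      case True
      have "real \<gamma> \<le> real M * real \<theta>" using *(1) by (metis of_nat_le_iff of_nat_mult)
      then have "2 / real M \<le> 2 * real \<theta> / real \<gamma>" by (rule lin)
      also have "\<dots> \<le> sin (2 * real \<theta> / real \<gamma> * (pi / 2))"
        using True assms by (intro sin_ge_linear) (auto simp: field_simps)
      finally show ?thesis by (simp add: mult_ac)
    next
      case False
      have "real \<gamma> \<le> real M * real (\<gamma> - \<theta>)" using *(2) by (metis of_nat_le_iff of_nat_mult)
      then have "2 / real M \<le> 2 * real (\<gamma> - \<theta>) / real \<gamma>" by (rule lin)
      also have "\<dots> \<le> sin (2 * real (\<gamma> - \<theta>) / real \<gamma> * (pi / 2))"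
        using False assms \<theta> by (intro sin_ge_linear) (auto simp: field_simps of_nat_diff)
      also have "2 * real (\<gamma> - \<theta>) / real \<gamma> * (pi / 2) = pi - pi * real \<theta> / real \<gamma>"
        using assms \<theta> by (simp add: field_simps of_nat_diff)
      finally show ?thesis by (simp add: sin_diff)
    qed
    then have "(2 / real M)\<^sup>2 \<le> (sin (pi * real \<theta> / real \<gamma>))\<^sup>2" by (intro power_mono) auto
    then have "C * (2 / real M)\<^sup>2 \<le> C * (sin (pi * real \<theta> / real \<gamma>))\<^sup>2" using assms by (intro mult_left_mono)
    then have "?f \<theta> \<le> ?e" by (simp add: power_divide mult.commute)
    then show ?thesis unfolding if_not_P[OF False] by simp
  qed
  then have "(\<Sum>\<theta><\<gamma>. ?f \<theta>) \<le> (\<Sum>\<theta><\<gamma>. (if \<theta> \<in> B then 1 else 0) + ?e)"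
    by (intro sum_mono) auto
  also have "\<dots> = real (card B) + real \<gamma> * ?e"
  proof -
    have "{..<\<gamma>} \<inter> B = B" by (auto simp: B_def)
    then show ?thesis by (simp add: sum.distrib sum.If_cases)
  qed
  also have "real (card B) \<le> real \<gamma> * (if \<gamma> \<le> M then 1 / real \<gamma> else 3 / real M)"
  proof (cases "\<gamma> \<le> M")
    case True
    have "B \<subseteq> {0}"
    proof
      fix \<theta> assume \<theta>: "\<theta> \<in> B"
      have "\<gamma> \<le> M * m" if "m \<ge> 1" for m using True that by (metis mult.right_neutral mult_le_mono)
      then show "\<theta> \<in> {0}" using \<theta>
        by (cases "\<theta> = 0") (force simp: B_def not_less[symmetric] Suc_le_eq)+
    qed
    then have "card B \<le> 1" using card_mono[of "{0::nat}"] by fastforce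
    then show ?thesis using True assms by simp
  next
    case False
    let ?p = "\<gamma> div M"
    \<comment> \<open>The lower range contains 0 and has \<open>?p + 1\<close> elements; the upper
      one excludes \<open>\<gamma>\<close> and has at most \<open>?p\<close>.\<close>
    have "B \<subseteq> {..?p} \<union> {\<gamma> - ?p..<\<gamma>}"
    proof
      fix \<theta> assume \<theta>: "\<theta> \<in> B"
      have "m \<le> ?p" if "M * m < \<gamma>" for m
        using that assms by (simp add: less_eq_div_iff_mult_less_eq mult.commute)
      then have "\<theta> \<le> ?p \<or> \<gamma> - \<theta> \<le> ?p" using \<theta> by (auto simp: B_def)
      then show "\<theta> \<in> {..?p} \<union> {\<gamma> - ?p..<\<gamma>}" using \<theta> by (auto simp: B_def)
    qed
    then have "card B \<le> card ({..?p} \<union> {\<gamma> - ?p..<\<gamma>})" by (intro card_mono) auto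
    also have "\<dots> \<le> (?p + 1) + ?p" by (rule order_trans[OF card_Un_le]) simp
    finally have "real (card B) \<le> 2 * real ?p + 1" by linarith
    also have "real ?p \<le> real \<gamma> / real M" by (rule of_nat_div_le_of_nat)
    also have "1 \<le> real \<gamma> / real M" using False assms by simp
    finally show ?thesis using False by (simp add: mult.commute)
  qed
  finally have "(\<Sum>\<theta><\<gamma>. ?f \<theta>) \<le> real \<gamma> * ((if \<gamma> \<le> M then 1 / real \<gamma> else 3 / real M) + ?e)"
    by (simp add: distrib_left)
  then show ?thesis
    using assms by (simp add: gauss_average_def divide_le_eq mult.commute)
qed

subsection \<open>Random walks on Cayley graphs\<close>

text \<open>Turns probabilities over the random generators into counting of lists.\<close>

lemma replicate_pmf_of_set:
  assumes "finite A" "A \<noteq> {}"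
  shows "replicate_pmf k (pmf_of_set A) = pmf_of_set {xs. set xs \<subseteq> A \<and> length xs = k}"
proof (induction k)
  case 0
  have "{xs. set xs \<subseteq> A \<and> length xs = 0} = {[]}" by auto
  then show ?case by (simp add: pmf_of_set_singleton)
next
  case (Suc k)
  let ?L = "{xs. set xs \<subseteq> A \<and> length xs = k}"
  obtain a where "a \<in> A" using assms(2) by blast
  then have "replicate k a \<in> ?L" by auto
  then have L: "finite ?L" "?L \<noteq> {}"
    using finite_lists_length_eq[OF assms(1)] by blast+
  have pair: "pair_pmf (pmf_of_set A) (pmf_of_set ?L) = pmf_of_set (A \<times> ?L)"
  proof (rule pmf_eqI)
    fix p show "pmf (pair_pmf (pmf_of_set A) (pmf_of_set ?L)) p = pmf (pmf_of_set (A \<times> ?L)) p"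
      using assms L by (cases p) (auto simp: pmf_pair indicator_def card_cartesian_product)
  qed
  have "replicate_pmf (Suc k) (pmf_of_set A) = map_pmf (\<lambda>(x, xs). x # xs) (pair_pmf (pmf_of_set A) (pmf_of_set ?L))"
    by (simp add: Suc pair_pmf_def map_pmf_def bind_assoc_pmf bind_return_pmf)
  also have "\<dots> = pmf_of_set ((\<lambda>(x, xs). x # xs) ` (A \<times> ?L))"
    unfolding pair using assms L by (intro map_pmf_of_set_inj) (auto simp: inj_on_def)
  also have "(\<lambda>(x, xs). x # xs) ` (A \<times> ?L) = {xs. set xs \<subseteq> A \<and> length xs = Suc k}"
    by (auto simp: length_Suc_conv)
  finally show ?case .
qed

section \<open>Edge boundaries in Cayley graphs\<close>

context group
begin

lemma card_translate_in:
  assumes a: "a \<in> carrier G" and S: "S \<subseteq> carrier G"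
  shows "card {x \<in> carrier G. x \<otimes> a \<in> S} = card S"
proof (rule bij_betw_same_card)
  show "bij_betw (\<lambda>x. x \<otimes> a) {x \<in> carrier G. x \<otimes> a \<in> S} S"
    by (rule bij_betwI[where g = "\<lambda>x. x \<otimes> inv a"]) (use a S in \<open>auto simp: m_assoc subset_iff\<close>)
qed

text \<open>Right translation by \<open>a\<close> permutes the group, so as many points enter
  \<open>S\<close> as leave it. This makes the directed and undirected constants agree.\<close>

lemma card_flow_balance:
  assumes fin: "finite (carrier G)" and a: "a \<in> carrier G" and S: "S \<subseteq> carrier G"
  shows "card {x \<in> carrier G - S. x \<otimes> a \<in> S} = card {x \<in> S. x \<otimes> a \<notin> S}"
proof -
  have finS: "finite S" using S fin finite_subset by blast
  have "card {x \<in> carrier G. x \<otimes> a \<in> S} = card {x \<in> S. x \<otimes> a \<in> S} + card {x \<in> carrier G - S. x \<otimes> a \<in> S}"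
    using fin finS S by (subst card_Un_disjoint[symmetric]) (auto intro!: arg_cong[of _ _ card])
  moreover have "card S = card {x \<in> S. x \<otimes> a \<in> S} + card {x \<in> S. x \<otimes> a \<notin> S}"
    using finS by (subst card_Un_disjoint[symmetric]) (auto intro!: arg_cong[of _ _ card])
  ultimately show ?thesis using card_translate_in[OF a S] by linarith
qed

lemma card_escape_inv:
  assumes fin: "finite (carrier G)" and a: "a \<in> carrier G" and S: "S \<subseteq> carrier G"
  shows "card {x \<in> S. x \<otimes> inv a \<notin> S} = card {x \<in> S. x \<otimes> a \<notin> S}"
proof -
  have "bij_betw (\<lambda>x. x \<otimes> inv a) {x \<in> S. x \<otimes> inv a \<notin> S} {x \<in> carrier G - S. x \<otimes> a \<in> S}"
    by (rule bij_betwI[where g = "\<lambda>x. x \<otimes> a"]) (use a S in \<open>auto simp: m_assoc subset_iff\<close>)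
  from bij_betw_same_card[OF this] show ?thesis using card_flow_balance[OF assms] by (rule trans)
qed

lemma card_Collect_times_lessThan:
  assumes "finite A"
  shows "card {(x, i). x \<in> A \<and> i < (k :: nat) \<and> P x i} = (\<Sum>i<k. card {x \<in> A. P x i})"
proof -
  have "bij_betw (\<lambda>(i, x). (x, i)) (SIGMA i:{..<k}. {x \<in> A. P x i}) {(x, i). x \<in> A \<and> i < k \<and> P x i}"
    by (rule bij_betwI[where g = "\<lambda>(x, i). (i, x)"]) auto
  then have "card (SIGMA i:{..<k}. {x \<in> A. P x i}) = card {(x, i). x \<in> A \<and> i < k \<and> P x i}"
    by (rule bij_betw_same_card)
  moreover have "card (SIGMA i:{..<k}. {x \<in> A. P x i}) = (\<Sum>i<k. card {x \<in> A. P x i})"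
    by (rule card_SigmaI) (use assms in auto)
  ultimately show ?thesis by (rule trans[OF sym])
qed

lemma size_directed_boundary:
  assumes fin: "finite (carrier G)" and zs: "set zs \<subseteq> carrier G" and S: "S \<subseteq> carrier G"
  shows "size (directed_boundary (carrier G) (directed_cayley_edges G zs) S)
    = (\<Sum>i<length zs. card {x \<in> S. x \<otimes> zs ! i \<notin> S})"
proof -
  have zc: "zs ! i \<in> carrier G" if "i < length zs" for i using zs that nth_mem by blast
  have finS: "finite S" using S fin finite_subset by blast
  have "size (directed_boundary (carrier G) (directed_cayley_edges G zs) S)
      = card {p \<in> carrier G \<times> {..<length zs}. (case p of (g, i) \<Rightarrow> g \<in> S \<and> g \<otimes> zs ! i \<in> carrier G - S)}"
    using fin by (simp add: directed_boundary_def directed_cayley_edges_def filter_mset_image_mset split_def)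
  also have "{p \<in> carrier G \<times> {..<length zs}. (case p of (g, i) \<Rightarrow> g \<in> S \<and> g \<otimes> zs ! i \<in> carrier G - S)}
      = {(x, i). x \<in> S \<and> i < length zs \<and> x \<otimes> zs ! i \<notin> S}"
    using zc S by auto
  finally show ?thesis
    using card_Collect_times_lessThan[OF finS] by simp
qed

text \<open>An edge crosses the boundary outwards or inwards along its generator, equally often by
  the flow balance. The resulting 2 matches the degree, which is twice the number of
  generators.\<close>

lemma size_undirected_boundary:
  assumes fin: "finite (carrier G)" and zs: "set zs \<subseteq> carrier G" and S: "S \<subseteq> carrier G"
  shows "size (undirected_boundary (carrier G) (undirected_cayley_edges G zs) S)
    = 2 * (\<Sum>i<length zs. card {x \<in> S. x \<otimes> zs ! i \<notin> S})"
proof -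
  let ?k = "length zs"
  let ?D = "{(x, i). x \<in> S \<and> i < ?k \<and> x \<otimes> zs ! i \<notin> S}"
  let ?D' = "{(x, i). x \<in> carrier G - S \<and> i < ?k \<and> x \<otimes> zs ! i \<in> S}"
  have finS: "finite S" using S fin finite_subset by blast
  have zc: "zs ! i \<in> carrier G" if "i < ?k" for i using zs that nth_mem by blast
  have crossing: "(\<exists>a\<in>S. \<exists>b\<in>carrier G - S. {g, h} = {a, b}) \<longleftrightarrow> g \<in> S \<and> h \<notin> S \<or> g \<notin> S \<and> h \<in> S"
    if "g \<in> carrier G" "h \<in> carrier G" for g h
    unfolding doubleton_eq_iff using that by blast
  have "size (undirected_boundary (carrier G) (undirected_cayley_edges G zs) S)
      = card {p \<in> carrier G \<times> {..<?k}. (case p of (g, i) \<Rightarrow> \<exists>a\<in>S. \<exists>b\<in>carrier G - S. {g, g \<otimes> zs ! i} = {a, b})}"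
    using fin by (simp add: undirected_boundary_def undirected_cayley_edges_def filter_mset_image_mset split_def)
  also have "{p \<in> carrier G \<times> {..<?k}. (case p of (g, i) \<Rightarrow> \<exists>a\<in>S. \<exists>b\<in>carrier G - S. {g, g \<otimes> zs ! i} = {a, b})}
      = {p \<in> carrier G \<times> {..<?k}. (case p of (g, i) \<Rightarrow> g \<in> S \<and> g \<otimes> zs ! i \<notin> S \<or> g \<notin> S \<and> g \<otimes> zs ! i \<in> S)}"
    by (intro Collect_cong conj_cong refl) (use zc in \<open>clarsimp simp: crossing\<close>)
  also have "\<dots> = ?D \<union> ?D'" using S by auto
  also have "card (?D \<union> ?D') = card ?D + card ?D'"
  proof (rule card_Un_disjoint)
    show "finite ?D" by (rule finite_subset[of _ "S \<times> {..<?k}"]) (use finS in auto)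
    show "finite ?D'" by (rule finite_subset[of _ "carrier G \<times> {..<?k}"]) (use fin in auto)
  qed auto
  also have "card ?D = (\<Sum>i<?k. card {x \<in> S. x \<otimes> zs ! i \<notin> S})"
    by (rule card_Collect_times_lessThan[OF finS])
  also have "card ?D' = (\<Sum>i<?k. card {x \<in> carrier G - S. x \<otimes> zs ! i \<in> S})"
    by (rule card_Collect_times_lessThan) (use fin in auto)
  also have "\<dots> = (\<Sum>i<?k. card {x \<in> S. x \<otimes> zs ! i \<notin> S})"
    by (intro sum.cong refl card_flow_balance fin S zc) auto
  finally show ?thesis by simp
qed

lemma isoperimetric_ge:
  assumes fin: "finite (carrier G)" and zs: "set zs \<subseteq> carrier G" "zs \<noteq> []"
    and N: "card (carrier G) \<ge> 2"
    and bound: "\<And>S. S \<subseteq> carrier G \<Longrightarrow> real (card S) \<le> card (carrier G) / 2 \<Longrightarrow>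
      \<kappa> * (real (length zs) * real (card S)) \<le> (\<Sum>i<length zs. real (card {x \<in> S. x \<otimes> zs ! i \<notin> S}))"
  shows "\<kappa> \<le> undirected_cayley_isoperimetric G zs" and "\<kappa> \<le> directed_cayley_isoperimetric G zs"
proof -
  let ?A = "{S. S \<subseteq> carrier G \<and> 1 \<le> card S \<and> real (card S) \<le> real (card (carrier G)) / 2}"
  have A: "finite ?A" by (rule finite_subset[of _ "Pow (carrier G)"]) (use fin in auto)
  \<comment> \<open>With at least two group elements a singleton is an admissible set, so
    \<open>Min\<close> is taken over a nonempty set.\<close>
  have "{\<one>} \<in> ?A" using N by simp
  then have ne: "?A \<noteq> {}" by blast
  have Min_ge: "\<kappa> \<le> Min {h S | S. S \<subseteq> carrier G \<and> 1 \<le> card S \<and> real (card S) \<le> real (card (carrier G)) / 2}"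
    if "\<And>S. S \<in> ?A \<Longrightarrow> \<kappa> \<le> h S" for h :: "'a set \<Rightarrow> real"
  proof -
    have "{h S | S. S \<subseteq> carrier G \<and> 1 \<le> card S \<and> real (card S) \<le> real (card (carrier G)) / 2} = h ` ?A"
      by (auto simp: image_def)
    then show ?thesis using A ne that by simp
  qed
  have pos: "real (length zs) * real (card S) > 0" if "S \<in> ?A" for S
    using that zs by simp
  show "\<kappa> \<le> directed_cayley_isoperimetric G zs"
    unfolding directed_cayley_isoperimetric_def directed_isoperimetric_def
  proof (rule Min_ge)
    fix S assume S: "S \<in> ?A"
    then show "\<kappa> \<le> real (size (directed_boundary (carrier G) (directed_cayley_edges G zs) S)) / (real (length zs) * real (card S))"
      using bound[of S] pos[OF S] by (simp add: size_directed_boundary[OF fin zs(1)] pos_le_divide_eq)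
  qed
  show "\<kappa> \<le> undirected_cayley_isoperimetric G zs"
    unfolding undirected_cayley_isoperimetric_def undirected_isoperimetric_def
  proof (rule Min_ge)
    fix S assume S: "S \<in> ?A"
    have "real (size (undirected_boundary (carrier G) (undirected_cayley_edges G zs) S)) / (real (2 * length zs) * real (card S))
        = (\<Sum>i<length zs. real (card {x \<in> S. x \<otimes> zs ! i \<notin> S})) / (real (length zs) * real (card S))"
      using S by (simp add: size_undirected_boundary[OF fin zs(1)])
    then show "\<kappa> \<le> real (size (undirected_boundary (carrier G) (undirected_cayley_edges G zs) S)) / (real (2 * length zs) * real (card S))"
      using S bound[of S] pos[OF S] by (simp add: pos_le_divide_eq)
  qed
qed

section \<open>Return probabilities as word counts, and expansion from a small excess\<close>

definition trivial_words :: "nat \<Rightarrow> 'a list \<Rightarrow> nat \<Rightarrow> (nat \<times> bool \<times> bool) list set" where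
  "trivial_words k zs n = {w. set w \<subseteq> steps k \<and> length w = n
     \<and> word_eval G ((!) zs) (map (\<lambda>(i, s). (i, step_exp s)) w) = \<one>}"

text \<open>This is \<open>|G| p - 1\<close> for the return probability \<open>p\<close> after
  \<open>n\<close> steps. Expressing \<open>p\<close> by counted words, with \<open>4 * k\<close>
  step indices, prepares for exchanging the sums over words and over generators.\<close>

definition excess :: "nat \<Rightarrow> nat \<Rightarrow> 'a list \<Rightarrow> real" where
  "excess k n zs = card (carrier G) * (card (trivial_words k zs n) / (4 * real k) ^ n) - 1"

lemma symmetric_walk_steps:
  assumes "finite (carrier G)" and "set zs \<subseteq> carrier G" and k: "length zs = k" "k > 0"
  shows "symmetric_walk G (steps k) (\<lambda>(i, s). zs ! i [^] step_exp s) (\<lambda>(i, a, b). (i, b, a))"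
proof unfold_locales
  have zc: "zs ! i \<in> carrier G" if "i < k" for i using assms that nth_mem by blast
  show "finite (steps k)" by (rule finite_steps)
  show "steps k \<noteq> {}" using k by (auto simp: steps_def)
  show "(\<lambda>(i, s). zs ! i [^] step_exp s) t \<in> carrier G" if "t \<in> steps k" for t
    using that zc by (auto simp: steps_def)
  show "bij_betw (\<lambda>(i, a, b). (i, b, a)) (steps k) (steps k)"
    by (rule bij_betwI[where g = "\<lambda>(i, a, b). (i, b, a)"]) (auto simp: steps_def)
  show "(\<lambda>(i, s). zs ! i [^] step_exp s) ((\<lambda>(i, a, b). (i, b, a)) t) = inv ((\<lambda>(i, s). zs ! i [^] step_exp s) t)"
    if t: "t \<in> steps k" for t
  proof -
    obtain i a b where "t = (i, a, b)" "i < k" using t by (auto simp: steps_def)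
    then show ?thesis using zc int_pow_neg[of "zs ! i" "step_exp (a, b)"] by (simp add: step_exp_def)
  qed
qed (rule assms(1))

text \<open>The lazy walk with steps \<open>zs ! i [^] step_exp s\<close> is a symmetric walk whose
  word values are those of \<open>word_eval\<close>, so its nonnegativity and escape bounds
  apply.\<close>

lemma
  assumes fin: "finite (carrier G)" and zs: "set zs \<subseteq> carrier G" "length zs = k" "k > 0"
  shows excess_nonneg: "0 \<le> excess k (2 * m) zs"
    and excess_isoperimetric: "\<lbrakk>card (carrier G) \<ge> 2; excess k (2 * m) zs \<le> r ^ (2 * m); 0 \<le> r; r \<le> 1; m > 0\<rbrakk>
      \<Longrightarrow> 1 - r \<le> undirected_cayley_isoperimetric G zs \<and> 1 - r \<le> directed_cayley_isoperimetric G zs"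
proof -
  let ?\<sigma> = "\<lambda>(i, s). zs ! i [^] step_exp s"
  interpret W: symmetric_walk G "steps k" ?\<sigma> "\<lambda>(i, a, b). (i, b, a)"
    by (rule symmetric_walk_steps[OF assms])
  have zc: "zs ! i \<in> carrier G" if "i < k" for i using zs that nth_mem by blast
  have "W.word_value w = word_eval G ((!) zs) (map (\<lambda>(i, s). (i, step_exp s)) w)" for w
    by (induction w) (auto simp: W.word_value_def word_eval_def)
  then have ex: "excess k n zs = card (carrier G) * W.return_prob n - 1" for n
    by (simp add: excess_def W.return_prob_def trivial_words_def card_steps)
  show "0 \<le> excess k (2 * m) zs"
    using W.return_prob_ge[of m] W.card_carrier_pos by (simp add: ex field_simps)
  show "1 - r \<le> undirected_cayley_isoperimetric G zs \<and> 1 - r \<le> directed_cayley_isoperimetric G zs"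
    if N: "card (carrier G) \<ge> 2" and r: "excess k (2 * m) zs \<le> r ^ (2 * m)" "0 \<le> r" "r \<le> 1" "m > 0"
  proof -
    have "(1 - r) * (real (length zs) * real (card S)) \<le> (\<Sum>i<length zs. real (card {x \<in> S. x \<otimes> zs ! i \<notin> S}))"
      if S: "S \<subseteq> carrier G" and half: "real (card S) \<le> card (carrier G) / 2" for S
    proof -
      have "(1 - r) * card S / 2 * card (steps k) \<le> (\<Sum>t\<in>steps k. real (card {x \<in> S. x \<otimes> ?\<sigma> t \<notin> S}))"
        using r by (intro W.escape_bound[OF S half]) (auto simp: ex)
      \<comment> \<open>Of the four bit pairs two give the identity and never leave
        \<open>S\<close>; the other two give a generator and its inverse, which leave
        \<open>S\<close> equally often. With \<open>4 * k\<close> step indices this exactly cancels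
        the factor 1/2 of the escape bound.\<close>
      also have "\<dots> = (\<Sum>i<k. 2 * real (card {x \<in> S. x \<otimes> zs ! i \<notin> S}))"
      proof -
        have one: "card {x \<in> S. x \<otimes> \<one> \<notin> S} = 0" using S by (auto simp: card_eq_0_iff)
        show ?thesis
          unfolding sum_steps using zc S
          by (intro sum.cong) (auto simp: step_exp_def int_pow_neg one card_escape_inv[OF fin])
      qed
      finally show ?thesis using zs by (simp add: card_steps algebra_simps flip: sum_distrib_left)
    qed
    then show ?thesis
      using isoperimetric_ge[OF fin zs(1) _ N, of "1 - r"] zs by auto
  qed
qed

end

section \<open>Charging a word to the gcd of its exponent sums\<close>

lemma Gcd_exponents:
  assumes w: "set w \<subseteq> steps k"
  obtains u where "(\<Sum>(i, e)\<leftarrow>map (\<lambda>(i, s). (i, step_exp s)) w. u i * e) = int (nat (Gcd (exponent_sum w ` {..<k})))"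
proof -
  obtain u where "(\<Sum>i<k. u i * exponent_sum w i) = Gcd (exponent_sum w ` {..<k})"
    using bezout_finite_int[of "{..<k}" "exponent_sum w"] by auto
  then show thesis using that[of u] sum_exponents[OF w, of u] by simp
qed

text \<open>A word with zero exponent vector (gcd \<open>0\<close>) is charged to the index \<open>\<gamma> = n + 1\<close>, which no nonzero
  vector can attain.\<close>

lemma card_trivial_word_le:
  fixes G :: "('a, 'b) monoid_scheme" (structure)
  assumes nil: "nilpotent_group G" and fin: "finite (carrier G)" and "2 \<le> M" "M \<le> n"
    and w: "set w \<subseteq> steps k" "length w = n"
  shows "real (card (carrier G)) * card {zs. set zs \<subseteq> carrier G \<and> length zs = k
        \<and> word_eval G ((!) zs) (map (\<lambda>(i, s). (i, step_exp s)) w) = \<one>}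
    \<le> real (card (carrier G)) ^ k * (1 + (\<Sum>\<gamma> = 2..n + 1.
        (if \<gamma> \<le> M then real \<gamma> ^ min_gen_size (lower_central_sum G) else card (carrier G))
        * (if \<forall>i<k. int \<gamma> dvd exponent_sum w i then 1 else 0)))"
proof -
  let ?N = "real (card (carrier G))" and ?d = "min_gen_size (lower_central_sum G)"
  let ?w = "map (\<lambda>(i, s). (i, step_exp s)) w"
  let ?X = "{zs. set zs \<subseteq> carrier G \<and> length zs = k \<and> word_eval G ((!) zs) ?w = \<one>}"
  \<comment> \<open>The price of \<open>\<gamma>\<close>: the power bound up to the cutoff
    \<open>M\<close>, and beyond it the trivial bound that every tuple may kill the word.\<close>
  define B where "B \<gamma> = (if \<gamma> \<le> M then real \<gamma> ^ ?d else ?N)" for \<gamma> :: nat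
  define I where "I \<gamma> = (if \<forall>i<k. int \<gamma> dvd exponent_sum w i then 1 else 0 :: real)" for \<gamma> :: nat
  have X_le: "real (card ?X) \<le> ?N ^ k"
  proof -
    have "card ?X \<le> card {zs. set zs \<subseteq> carrier G \<and> length zs = k}"
      by (rule card_mono[OF finite_lists_length_eq[OF fin]]) auto
    then show ?thesis by (simp add: card_lists_length_eq[OF fin] flip: of_nat_power)
  qed
  have nonneg: "0 \<le> B \<gamma> * I \<gamma>" for \<gamma> by (simp add: B_def I_def)
  have term_le: "B \<gamma> * I \<gamma> \<le> (\<Sum>\<gamma> = 2..n + 1. B \<gamma> * I \<gamma>)" if "\<gamma> \<in> {2..n + 1}" for \<gamma>
    using that nonneg by (intro member_le_sum) auto
  \<comment> \<open>All terms of the sum are nonnegative, so one index that divides all exponent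
    sums and whose price suffices is enough.\<close>
  have charge: "?N * card ?X \<le> ?N ^ k * (1 + (\<Sum>\<gamma> = 2..n + 1. B \<gamma> * I \<gamma>))"
    if "\<gamma> \<in> {2..n + 1}" "I \<gamma> = 1" "?N * card ?X \<le> ?N ^ k * B \<gamma>" for \<gamma>
  proof -
    have "?N ^ k * B \<gamma> \<le> ?N ^ k * (1 + (\<Sum>\<gamma> = 2..n + 1. B \<gamma> * I \<gamma>))"
      using term_le[OF that(1)] that(2) by (intro mult_left_mono) auto
    with that(3) show ?thesis by linarith
  qed
  have trivial: "?N * card ?X \<le> ?N ^ k * ?N"
  proof -
    have "?N * card ?X \<le> ?N * ?N ^ k" by (intro mult_left_mono X_le) simp
    then show ?thesis by (simp only: mult.commute)
  qed
  define g where "g = nat (Gcd (exponent_sum w ` {..<k}))"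
  have int_g: "int g = Gcd (exponent_sum w ` {..<k})" by (simp add: g_def)
  have g_dvd: "int g dvd exponent_sum w i" if "i < k" for i
    unfolding int_g using that by (intro Gcd_dvd) auto
  have "?N * card ?X \<le> ?N ^ k * (1 + (\<Sum>\<gamma> = 2..n + 1. B \<gamma> * I \<gamma>))"
  proof (cases "g = 0")
    case True
    then have "I (n + 1) = 1" using g_dvd by (auto simp: I_def)
    moreover have "B (n + 1) = ?N" using \<open>M \<le> n\<close> by (simp add: B_def)
    moreover have "n + 1 \<in> {2..n + 1}" using \<open>2 \<le> M\<close> \<open>M \<le> n\<close> by simp
    ultimately show ?thesis using trivial charge[of "n + 1"] by simp
  next
    case False
    obtain u where u: "(\<Sum>(i, e)\<leftarrow>?w. u i * e) = int g"
      using Gcd_exponents[OF w(1)] unfolding g_def by blast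
    have idx: "i < k" if "(i, e) \<in> set ?w" for i e
      using that w(1) by (auto simp: steps_def)
    have "card ?X * card (carrier G) \<le> g ^ ?d * card (carrier G) ^ k"
      using card_trivial_word[OF nil fin idx u] False by simp
    then have "real (card ?X * card (carrier G)) \<le> real (g ^ ?d * card (carrier G) ^ k)"
      by (rule of_nat_mono)
    then have torsion: "?N * card ?X \<le> ?N ^ k * real g ^ ?d"
      by (simp add: mult.commute)
    show ?thesis
    proof (cases "g = 1")
      case True
      \<comment> \<open>For gcd 1 the leading 1 already covers the bound; it is the contribution of
        exact equidistribution.\<close>
      have "0 \<le> (\<Sum>\<gamma> = 2..n + 1. B \<gamma> * I \<gamma>)" using nonneg by (intro sum_nonneg) auto
      then have "?N ^ k * 1 \<le> ?N ^ k * (1 + (\<Sum>\<gamma> = 2..n + 1. B \<gamma> * I \<gamma>))"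
        by (intro mult_left_mono) auto
      then show ?thesis using torsion True by simp
    next
      case ne1: False
      \<comment> \<open>A nonzero exponent sum is divisible by \<open>g\<close> and at most
        \<open>n\<close> in absolute value, which places \<open>g\<close> in the range of the
        sum.\<close>
      have "\<exists>i<k. exponent_sum w i \<noteq> 0"
      proof (rule ccontr)
        assume "\<not> ?thesis"
        then have "Gcd (exponent_sum w ` {..<k}) = 0" by (auto simp: Gcd_0_iff)
        then show False using False by (simp add: g_def)
      qed
      then obtain i where i: "i < k" "exponent_sum w i \<noteq> 0" by auto
      have "int g \<le> \<bar>exponent_sum w i\<bar>" using dvd_imp_le_int[OF i(2) g_dvd[OF i(1)]] by simp
      also have "\<dots> \<le> int n" using abs_exponent_sum_le[of w i] w(2) by simp
      finally have "g \<in> {2..n + 1}" using False ne1 by simp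
      moreover have "I g = 1" using g_dvd by (simp add: I_def)
      moreover have "?N * card ?X \<le> ?N ^ k * B g"
        using torsion trivial by (simp add: B_def)
      ultimately show ?thesis by (rule charge)
    qed
  qed
  then show ?thesis by (simp only: B_def I_def)
qed

subsection \<open>The expected return probability\<close>

text \<open>Double counting of pairs of a generator tuple and a trivial word. Each word is bounded
  by its charges, and the words charged to \<open>\<gamma>\<close> are counted by
  \<open>card_words_dvd\<close>. The leading 1 of the charge bound is cancelled by the 1 subtracted
  in \<open>excess\<close>.\<close>

lemma sum_excess_le:
  fixes G :: "('a, 'b) monoid_scheme" (structure)
  assumes nil: "nilpotent_group G" and fin: "finite (carrier G)" and k: "k > 0" and M: "2 \<le> M" "M \<le> C * k"
  shows "(\<Sum>zs | set zs \<subseteq> carrier G \<and> length zs = k. group.excess G k (C * k) zs)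
    \<le> real (card (carrier G)) ^ k * (\<Sum>\<gamma> = 2..C * k + 1.
        (if \<gamma> \<le> M then real \<gamma> ^ min_gen_size (lower_central_sum G) else card (carrier G)) * gauss_average C \<gamma> ^ k)"
proof -
  interpret group G using nil by (simp add: nilpotent_group_def)
  define n where "n = C * k"
  define \<Omega> where "\<Omega> = {zs. set zs \<subseteq> carrier G \<and> length zs = k}"
  define W where "W = {w. set w \<subseteq> steps k \<and> length w = n}"
  let ?N = "real (card (carrier G))" and ?d = "min_gen_size (lower_central_sum G)"
  define B where "B \<gamma> = (if \<gamma> \<le> M then real \<gamma> ^ ?d else ?N)" for \<gamma> :: nat
  define P where "P zs w \<longleftrightarrow> word_eval G ((!) zs) (map (\<lambda>(i, s). (i, step_exp s)) w) = \<one>" for zs w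
  define J where "J w \<gamma> = (if \<forall>i<k. int \<gamma> dvd exponent_sum w i then 1 else 0 :: real)" for w and \<gamma> :: nat
  have fin\<Omega>: "finite \<Omega>" unfolding \<Omega>_def by (rule finite_lists_length_eq[OF fin])
  have card\<Omega>: "real (card \<Omega>) = ?N ^ k" unfolding \<Omega>_def by (simp add: card_lists_length_eq[OF fin])
  have finW: "finite W" unfolding W_def by (rule finite_lists_length_eq[OF finite_steps])
  have cardW: "real (card W) = (4 * real k) ^ n"
    unfolding W_def by (simp add: card_lists_length_eq[OF finite_steps] card_steps)
  have pos: "(4 * real k) ^ n > 0" using k by simp
  have word: "?N * (\<Sum>zs\<in>\<Omega>. if P zs w then 1 else 0) \<le> ?N ^ k * (1 + (\<Sum>\<gamma> = 2..n + 1. B \<gamma> * J w \<gamma>))"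
    if "w \<in> W" for w
  proof -
    have "(\<Sum>zs\<in>\<Omega>. if P zs w then 1 else 0 :: real) = card (\<Omega> \<inter> {zs. P zs w})"
      using fin\<Omega> by (simp add: sum.If_cases)
    also have "\<Omega> \<inter> {zs. P zs w} = {zs. set zs \<subseteq> carrier G \<and> length zs = k
        \<and> word_eval G ((!) zs) (map (\<lambda>(i, s). (i, step_exp s)) w) = \<one>}"
      by (auto simp: \<Omega>_def P_def)
    finally show ?thesis
      using card_trivial_word_le[OF nil fin M(1) M(2)[folded n_def], of w k] that
      by (simp add: W_def B_def J_def)
  qed
  have words: "(\<Sum>w\<in>W. J w \<gamma>) \<le> (4 * real k) ^ n * gauss_average C \<gamma> ^ k" if "\<gamma> \<in> {2..n + 1}" for \<gamma>
  proof -
    have "(\<Sum>w\<in>W. J w \<gamma>) = card (W \<inter> {w. \<forall>i<k. int \<gamma> dvd exponent_sum w i})"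
      using finW by (simp add: J_def sum.If_cases)
    also have "W \<inter> {w. \<forall>i<k. int \<gamma> dvd exponent_sum w i}
        = {w. set w \<subseteq> steps k \<and> length w = C * k \<and> (\<forall>i<k. int \<gamma> dvd exponent_sum w i)}"
      by (auto simp: W_def n_def)
    finally show ?thesis using card_words_dvd[OF k, of \<gamma> C] that by (simp add: n_def)
  qed
  have "(\<Sum>zs\<in>\<Omega>. real (card (trivial_words k zs n))) = (\<Sum>zs\<in>\<Omega>. \<Sum>w\<in>W. if P zs w then 1 else 0)"
  proof (rule sum.cong[OF refl])
    fix zs
    have "trivial_words k zs n = W \<inter> {w. P zs w}" by (auto simp: trivial_words_def W_def P_def)
    then show "real (card (trivial_words k zs n)) = (\<Sum>w\<in>W. if P zs w then 1 else 0)"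
      using finW by (simp add: sum.If_cases)
  qed
  also have "\<dots> = (\<Sum>w\<in>W. \<Sum>zs\<in>\<Omega>. if P zs w then 1 else 0)" by (rule sum.swap)
  finally have "?N * (\<Sum>zs\<in>\<Omega>. real (card (trivial_words k zs n))) = (\<Sum>w\<in>W. ?N * (\<Sum>zs\<in>\<Omega>. if P zs w then 1 else 0))"
    by (simp only: sum_distrib_left)
  also have "\<dots> \<le> (\<Sum>w\<in>W. ?N ^ k * (1 + (\<Sum>\<gamma> = 2..n + 1. B \<gamma> * J w \<gamma>)))"
    by (intro sum_mono word)
  also have "\<dots> = ?N ^ k * ((4 * real k) ^ n + (\<Sum>w\<in>W. \<Sum>\<gamma> = 2..n + 1. B \<gamma> * J w \<gamma>))"
    by (simp only: sum_distrib_left[symmetric] sum.distrib cardW[symmetric]) simp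
  also have "(\<Sum>w\<in>W. \<Sum>\<gamma> = 2..n + 1. B \<gamma> * J w \<gamma>) = (\<Sum>\<gamma> = 2..n + 1. B \<gamma> * (\<Sum>w\<in>W. J w \<gamma>))"
    by (subst sum.swap) (simp only: sum_distrib_left)
  also have "?N ^ k * ((4 * real k) ^ n + \<dots>)
      \<le> ?N ^ k * ((4 * real k) ^ n + (\<Sum>\<gamma> = 2..n + 1. B \<gamma> * ((4 * real k) ^ n * gauss_average C \<gamma> ^ k)))"
    by (intro mult_left_mono add_left_mono sum_mono words) (auto simp: B_def)
  also have "(\<Sum>\<gamma> = 2..n + 1. B \<gamma> * ((4 * real k) ^ n * gauss_average C \<gamma> ^ k))
      = (4 * real k) ^ n * (\<Sum>\<gamma> = 2..n + 1. B \<gamma> * gauss_average C \<gamma> ^ k)"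
    by (simp only: sum_distrib_left mult.left_commute)
  finally have main: "?N * (\<Sum>zs\<in>\<Omega>. real (card (trivial_words k zs n)))
      \<le> ?N ^ k * ((4 * real k) ^ n + (4 * real k) ^ n * (\<Sum>\<gamma> = 2..n + 1. B \<gamma> * gauss_average C \<gamma> ^ k))" .
  have "(\<Sum>zs\<in>\<Omega>. excess k n zs) = ?N * (\<Sum>zs\<in>\<Omega>. real (card (trivial_words k zs n))) / (4 * real k) ^ n - ?N ^ k"
    unfolding excess_def sum_subtractf by (simp add: sum_distrib_left sum_divide_distrib card\<Omega>)
  also have "\<dots> \<le> ?N ^ k * ((4 * real k) ^ n + (4 * real k) ^ n * (\<Sum>\<gamma> = 2..n + 1. B \<gamma> * gauss_average C \<gamma> ^ k)) / (4 * real k) ^ n - ?N ^ k"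
    by (intro diff_right_mono divide_right_mono main) (use pos in simp)
  also have "\<dots> = ?N ^ k * (\<Sum>\<gamma> = 2..n + 1. B \<gamma> * gauss_average C \<gamma> ^ k)"
  proof -
    have "u * (q + q * v) / q - u = u * v" if "q > 0" for u v q :: real
      using that by (simp add: field_simps)
    from this[OF pos] show ?thesis .
  qed
  finally show ?thesis by (simp only: n_def \<Omega>_def B_def)
qed

section \<open>Choice of constants and exponential decay\<close>

lemma gauss_average_nonneg: "0 \<le> gauss_average C \<gamma>"
  by (simp add: gauss_average_def sum_nonneg)

text \<open>For \<open>\<gamma> \<le> M\<close> the price is at most
  \<open>(\<gamma> powr a) ^ k\<close> while the average is nearly \<open>1 / \<gamma>\<close>; as
  \<open>a < 1\<close>, the worst case of \<open>\<gamma> powr (a - 1)\<close> is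
  \<open>\<gamma> = 2\<close>. For \<open>\<gamma> > M\<close> the price \<open>N\<close> costs
  \<open>exp (1 / c)\<close> per coordinate, and the lower bound on \<open>M\<close> brings the main
  part down to 1/4. The error term takes at most half of the gap between
  \<open>2 powr (a - 1)\<close> and 1.\<close>

lemma charge_decay:
  fixes c a C N :: real
  assumes "0 < c" "a < 1" "real d \<le> a * k" "0 < N" "N \<le> exp (k / c)" "C \<ge> 0"
    and M: "2 \<le> M" "12 * exp (1 / c) \<le> M" "M * exp (- 4 * C / (real M)\<^sup>2) \<le> (1 - 2 powr (a - 1)) / 2"
    and \<gamma>: "2 \<le> \<gamma>"
  shows "(if \<gamma> \<le> M then real \<gamma> ^ d else N) * gauss_average C \<gamma> ^ k \<le> ((1 + 2 powr (a - 1)) / 2) ^ k"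
proof -
  let ?q = "gauss_average C \<gamma>" and ?e = "exp (- 4 * C / (real M)\<^sup>2)" and ?p = "2 powr (a - 1)"
  have q0: "0 \<le> ?q" by (rule gauss_average_nonneg)
  have q: "?q \<le> (if \<gamma> \<le> M then 1 / real \<gamma> else 3 / real M) + ?e"
    using gauss_average_le[of M \<gamma> C] assms by simp
  show ?thesis
  proof (cases "\<gamma> \<le> M")
    case True
    have "real \<gamma> ^ d = real \<gamma> powr real d" using \<gamma> by (simp add: powr_realpow)
    also have "\<dots> \<le> real \<gamma> powr (a * k)" using \<gamma> assms by (intro powr_mono) auto
    also have "\<dots> = (real \<gamma> powr a) ^ k" using \<gamma> by (simp add: powr_powr[symmetric] powr_realpow)
    finally have "real \<gamma> ^ d * ?q ^ k \<le> (real \<gamma> powr a) ^ k * ?q ^ k"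
      using q0 by (intro mult_right_mono) auto
    also have "\<dots> = (real \<gamma> powr a * ?q) ^ k" by (simp add: power_mult_distrib)
    also have "\<dots> \<le> ((1 + ?p) / 2) ^ k"
    proof (rule power_mono)
      have "real \<gamma> powr a * ?q \<le> real \<gamma> powr a * (1 / real \<gamma> + ?e)"
        using q True by (intro mult_left_mono) auto
      also have "\<dots> = real \<gamma> powr (a - 1) + real \<gamma> powr a * ?e"
        using \<gamma> by (simp add: powr_diff ring_distribs)
      finally have 1: "real \<gamma> powr a * ?q \<le> real \<gamma> powr (a - 1) + real \<gamma> powr a * ?e" .
      have 2: "real \<gamma> powr (a - 1) \<le> ?p"
        using \<gamma> assms by (intro powr_mono2') auto
      have "real \<gamma> powr a * ?e \<le> real M * ?e"
      proof (rule mult_right_mono)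
        have "real \<gamma> powr a \<le> real \<gamma> powr 1" using \<gamma> assms by (intro powr_mono) auto
        then show "real \<gamma> powr a \<le> real M" using True \<gamma> by simp
      qed simp
      also have "real M * ?e \<le> (1 - ?p) / 2" by (rule M(3))
      finally show "real \<gamma> powr a * ?q \<le> (1 + ?p) / 2" using 1 2 by argo
    qed (use q0 in simp)
    finally show ?thesis using True by simp
  next
    case False
    have "exp (k / c) = exp (1 / c) ^ k" by (simp add: exp_of_nat_mult[symmetric])
    then have "N * ?q ^ k \<le> exp (1 / c) ^ k * ?q ^ k"
      using assms q0 by (intro mult_right_mono) auto
    also have "\<dots> = (exp (1 / c) * ?q) ^ k" by (simp add: power_mult_distrib)
    also have "\<dots> \<le> ((1 + ?p) / 2) ^ k"
    proof (rule power_mono)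
      have "exp (1 / c) * ?q \<le> real M / 12 * (3 / real M + ?e)"
        using q False M q0 by (intro mult_mono) auto
      also have "\<dots> = 1 / 4 + real M * ?e / 12" using M by (simp add: field_simps)
      also have "\<dots> \<le> 1 / 4 + (1 - ?p) / 2 / 12" by (intro add_left_mono divide_right_mono M(3)) simp
      also have "\<dots> \<le> (1 + ?p) / 2"
      proof -
        have "?p > 0" by simp
        then show ?thesis by argo
      qed
      finally show "exp (1 / c) * ?q \<le> (1 + ?p) / 2" .
    qed (use q0 in simp)
    finally show ?thesis using False by simp
  qed
qed

text \<open>The cutoff \<open>M\<close> depends only on \<open>c\<close>, and \<open>m\<close> is
  then taken large in terms of \<open>M\<close>. The word length per generator is
  \<open>2 * m\<close>, so the total length is even. The decay rate is written as
  \<open>s\<^sup>2\<close> so that Markov's inequality can spend one factor \<open>s\<close> on the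
  threshold and one on the probability.\<close>

lemma expansion_constants:
  fixes c :: real
  assumes "c > 0"
  obtains a s :: real and M m :: nat where
    "a = 1 / (1 + c * ln 2)" "a < 1" "0 < s" "s < 1" "s\<^sup>2 = (1 + 2 powr (a - 1)) / 2" "m > 0"
    "2 \<le> M" "12 * exp (1 / c) \<le> M" "M * exp (- 4 * real (2 * m) / (real M)\<^sup>2) \<le> (1 - 2 powr (a - 1)) / 2"
proof -
  define a where "a = 1 / (1 + c * ln 2)"
  have "c * ln 2 > 0" using assms by simp
  then have a: "a < 1" by (simp add: a_def)
  define p where "p = 2 powr (a - 1)"
  have p: "0 < p" "p < 1" using a by (simp_all add: p_def powr_less_one)
  define s where "s = sqrt ((1 + p) / 2)"
  have "0 < (1 + p) / 2" using p(1) by (simp add: add_pos_pos)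
  moreover have "(1 + p) / 2 < 1" using p(2) by simp
  ultimately have s: "0 < s" "s < 1" "s\<^sup>2 = (1 + p) / 2" unfolding s_def
    by (simp_all only: real_sqrt_gt_0_iff real_sqrt_lt_1_iff real_sqrt_pow2 less_imp_le)
  define M where "M = nat \<lceil>12 * exp (1 / c)\<rceil> + 2"
  have M: "2 \<le> M" "12 * exp (1 / c) \<le> M" by (auto simp: M_def) linarith
  let ?y = "(1 - p) / 2 / real M"
  have y: "?y > 0" using p M by simp
  \<comment> \<open>The bound comes from solving the last required inequality for \<open>m\<close>
    by taking logarithms.\<close>
  obtain m0 :: nat where m0: "- ln ?y * (real M)\<^sup>2 / 8 < real m0" using reals_Archimedean2 by blast
  define m where "m = Suc m0"
  have "- ln ?y * (real M)\<^sup>2 / 8 < real m" using m0 by (simp add: m_def)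
  then have "- 4 * real (2 * m) / (real M)\<^sup>2 \<le> ln ?y" using M by (simp add: field_simps)
  then have "exp (- 4 * real (2 * m) / (real M)\<^sup>2) \<le> exp (ln ?y)" by (simp only: exp_le_cancel_iff)
  then have "exp (- 4 * real (2 * m) / (real M)\<^sup>2) \<le> ?y" using y by (simp only: exp_ln)
  then have "M * exp (- 4 * real (2 * m) / (real M)\<^sup>2) \<le> (1 - p) / 2" using M by (simp add: field_simps)
  then show thesis using that[OF a_def a s[unfolded p_def] _ M, of m] by (simp add: m_def p_def)
qed

text \<open>Markov's inequality for the excess: its mean is at most
  \<open>2 * m * k * s ^ k * s ^ k\<close>, so it exceeds \<open>s ^ k\<close> with probability at
  most \<open>2 * m * k * s ^ k\<close>. Otherwise \<open>excess_isoperimetric\<close>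
  applies.\<close>

lemma whp_bound:
  fixes G :: "('a, 'b) monoid_scheme" and a c s :: real
  assumes c: "c > 0" and a: "a = 1 / (1 + c * ln 2)" "a < 1" and s: "0 < s" "s < 1" "s\<^sup>2 = (1 + 2 powr (a - 1)) / 2"
    and m: "m > 0"
    and M: "2 \<le> M" "12 * exp (1 / c) \<le> M" "M * exp (- 4 * real (2 * m) / (real M)\<^sup>2) \<le> (1 - 2 powr (a - 1)) / 2"
    and nil: "nilpotent_group G" and fin: "finite (carrier G)" and N: "card (carrier G) \<ge> 2" and k: "k \<ge> M"
    and gap: "real k - real (min_gen_size (lower_central_sum G)) \<ge> c * ln (real (card (carrier G)))"
    and \<kappa>: "\<kappa> = 1 - root (2 * m) s"
  shows "1 - real (2 * m) * (real k * s ^ k) \<le> measure_pmf.prob (random_generators G k)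
    {zs. \<kappa> \<le> undirected_cayley_isoperimetric G zs \<and> \<kappa> \<le> directed_cayley_isoperimetric G zs}"
proof -
  interpret group G using nil by (simp add: nilpotent_group_def)
  let ?N = "real (card (carrier G))" and ?d = "min_gen_size (lower_central_sum G)"
  let ?good = "{zs. \<kappa> \<le> undirected_cayley_isoperimetric G zs \<and> \<kappa> \<le> directed_cayley_isoperimetric G zs}"
  define n where "n = 2 * m * k"
  define \<Omega> where "\<Omega> = {zs. set zs \<subseteq> carrier G \<and> length zs = k}"
  have k0: "k > 0" using k M by simp
  have fin\<Omega>: "finite \<Omega>" unfolding \<Omega>_def by (rule finite_lists_length_eq[OF fin])
  have card\<Omega>: "real (card \<Omega>) = ?N ^ k" unfolding \<Omega>_def by (simp add: card_lists_length_eq[OF fin])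
  \<comment> \<open>Since \<open>?d * ln 2 \<le> ln ?N\<close>, the gap hypothesis yields
    \<open>k \<ge> ?d * (1 + c * ln 2)\<close>. This is the reason for the value of
    \<open>a\<close>.\<close>
  have "(2::real) ^ ?d \<le> ?N"
    using min_gen_size_log[OF nil fin] by (metis of_nat_le_iff of_nat_numeral of_nat_power)
  then have "ln ((2::real) ^ ?d) \<le> ln ?N" using N by (subst ln_le_cancel_iff) auto
  then have d: "real ?d * ln 2 \<le> ln ?N" by (simp add: ln_realpow)
  then have "c * (real ?d * ln 2) \<le> c * ln ?N" using c by (intro mult_left_mono) auto
  then have "real ?d * (1 + c * ln 2) \<le> k" using gap by (simp add: algebra_simps)
  moreover have "1 + c * ln 2 > 0" using c by (simp add: add_pos_pos)
  ultimately have dk: "real ?d \<le> a * k" by (simp add: a pos_le_divide_eq)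
  have "ln ?N \<le> k / c" using gap c by (simp add: pos_le_divide_eq mult.commute)
  then have Nk: "?N \<le> exp (k / c)" using N by (metis exp_le_cancel_iff exp_ln of_nat_0_less_iff less_le_trans zero_less_numeral)
  have Mn: "M \<le> 2 * m * k"
  proof -
    have "k \<le> 2 * m * k" using m by simp
    with k show ?thesis by (rule le_trans)
  qed
  have "(\<Sum>zs\<in>\<Omega>. excess k n zs) \<le> ?N ^ k * (\<Sum>\<gamma> = 2..n + 1.
        (if \<gamma> \<le> M then real \<gamma> ^ ?d else ?N) * gauss_average (2 * m) \<gamma> ^ k)"
    using sum_excess_le[OF nil fin k0 M(1) Mn] by (simp add: n_def \<Omega>_def)
  also have "\<dots> \<le> ?N ^ k * (\<Sum>\<gamma> = 2..n + 1. (s\<^sup>2) ^ k)"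
    unfolding s(3) using N
    by (intro mult_left_mono sum_mono charge_decay[OF c a(2) dk _ Nk _ M]) auto
  also have "\<dots> = ?N ^ k * (real n * (s ^ k * s ^ k))"
    by (simp add: power_mult[symmetric] mult.commute[of 2] power_mult power2_eq_square power_mult_distrib)
  finally have total: "(\<Sum>zs\<in>\<Omega>. excess k n zs) \<le> ?N ^ k * (real n * (s ^ k * s ^ k))" .
  define bad where "bad = {zs \<in> \<Omega>. excess k n zs > s ^ k}"
  have nonneg: "0 \<le> excess k n zs" if "zs \<in> \<Omega>" for zs
    using excess_nonneg[OF fin, of zs k "m * k"] that k0 by (simp add: \<Omega>_def n_def mult.assoc)
  have "real (card bad) * s ^ k = (\<Sum>zs\<in>bad. s ^ k)" by simp
  also have "\<dots> \<le> (\<Sum>zs\<in>bad. excess k n zs)" by (intro sum_mono) (auto simp: bad_def)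
  also have "\<dots> \<le> (\<Sum>zs\<in>\<Omega>. excess k n zs)"
    using fin\<Omega> nonneg by (intro sum_mono2) (auto simp: bad_def)
  also note total
  finally have "real (card bad) * s ^ k \<le> (?N ^ k * (real n * s ^ k)) * s ^ k" by (simp only: mult.assoc)
  then have bad: "real (card bad) \<le> ?N ^ k * (real n * s ^ k)" using s by simp
  \<comment> \<open>The walk runs for \<open>2 * m * k\<close> steps, so the threshold
    \<open>s ^ k\<close> is the matching power of a number that does not depend on \<open>k\<close>.
    Thus the isoperimetric bound is uniform.\<close>
  let ?r = "root (2 * m) s"
  have r: "0 \<le> ?r" "?r \<le> 1" using s m by simp_all
  have r_pow: "?r ^ (2 * (m * k)) = s ^ k"
  proof -
    have "?r ^ (2 * (m * k)) = (?r ^ (2 * m)) ^ k" by (simp only: power_mult[symmetric] mult.assoc)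
    also have "\<dots> = s ^ k" by (subst real_root_pow_pos2) (use s m in auto)
    finally show ?thesis .
  qed
  have "\<Omega> - bad \<subseteq> \<Omega> \<inter> ?good"
  proof
    fix zs assume zs: "zs \<in> \<Omega> - bad"
    then have "excess k (2 * (m * k)) zs \<le> ?r ^ (2 * (m * k))"
      unfolding r_pow by (simp add: bad_def n_def mult.assoc not_less)
    then show "zs \<in> \<Omega> \<inter> ?good"
      using excess_isoperimetric[OF fin _ _ k0 N, of zs "m * k" ?r] zs r m k0 by (auto simp: \<Omega>_def \<kappa>)
  qed
  then have "card (\<Omega> - bad) \<le> card (\<Omega> \<inter> ?good)" using fin\<Omega> by (intro card_mono) auto
  moreover have "card (\<Omega> - bad) = card \<Omega> - card bad" using fin\<Omega> by (intro card_Diff_subset) (auto simp: bad_def)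
  ultimately have "real (card \<Omega>) - real (card bad) \<le> card (\<Omega> \<inter> ?good)" by linarith
  then have "?N ^ k * (1 - real n * s ^ k) \<le> card (\<Omega> \<inter> ?good)"
    using bad by (simp add: card\<Omega> right_diff_distrib)
  then have "1 - real n * s ^ k \<le> card (\<Omega> \<inter> ?good) / card \<Omega>"
    using N unfolding card\<Omega> by (subst pos_le_divide_eq) (auto simp: mult.commute)
  also have "\<dots> = measure_pmf.prob (random_generators G k) ?good"
  proof -
    have ne: "carrier G \<noteq> {}" by blast
    have "\<Omega> \<noteq> {}" using card\<Omega> N by auto
    then show ?thesis
      unfolding random_generators_def replicate_pmf_of_set[OF fin ne] \<Omega>_def[symmetric]
      using fin\<Omega> by (simp add: measure_pmf_of_set)
  qed
  finally show ?thesis by (simp add: n_def mult.assoc)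
qed

theorem theorem5:
  fixes c :: real
  assumes "c > 0"
  shows "\<exists>c'::real. c' > 0 \<and>
    (\<forall>(G :: nat \<Rightarrow> ('a, 'b) monoid_scheme) (k :: nat \<Rightarrow> nat).
       (\<forall>N. nilpotent_group (G N) \<and> finite (carrier (G N))) \<longrightarrow>
       filterlim (\<lambda>N. card (carrier (G N))) at_top sequentially \<longrightarrow>
       (\<forall>N. real (k N) - real (min_gen_size (lower_central_sum (G N)))
              \<ge> c * ln (real (card (carrier (G N))))) \<longrightarrow>
       with_high_probability (\<lambda>N. random_generators (G N) (k N))
         (\<lambda>N zs. undirected_cayley_isoperimetric (G N) zs \<ge> c') \<and>
       with_high_probability (\<lambda>N. random_generators (G N) (k N))
         (\<lambda>N zs. directed_cayley_isoperimetric (G N) zs \<ge> c'))"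
proof -
  obtain a s :: real and M m :: nat where
    a: "a = 1 / (1 + c * ln 2)" "a < 1" and s: "0 < s" "s < 1" "s\<^sup>2 = (1 + 2 powr (a - 1)) / 2" and m: "m > 0"
    and M: "2 \<le> M" "12 * exp (1 / c) \<le> M" "M * exp (- 4 * real (2 * m) / (real M)\<^sup>2) \<le> (1 - 2 powr (a - 1)) / 2"
    by (rule expansion_constants[OF assms])
  define \<kappa> where "\<kappa> = 1 - root (2 * m) s"
  have "\<kappa> > 0" using s m by (simp add: \<kappa>_def)
  moreover have "with_high_probability (\<lambda>N. random_generators (G N) (k N))
         (\<lambda>N zs. \<kappa> \<le> undirected_cayley_isoperimetric (G N) zs) \<and>
       with_high_probability (\<lambda>N. random_generators (G N) (k N))
         (\<lambda>N zs. \<kappa> \<le> directed_cayley_isoperimetric (G N) zs)"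
    if nil: "\<And>N. nilpotent_group (G N)" and fin: "\<And>N. finite (carrier (G N))"
      and lim: "filterlim (\<lambda>N. card (carrier (G N))) at_top sequentially"
      and gap: "\<And>N. real (k N) - real (min_gen_size (lower_central_sum (G N))) \<ge> c * ln (real (card (carrier (G N))))"
    for G :: "nat \<Rightarrow> ('a, 'b) monoid_scheme" and k
  proof -
    \<comment> \<open>The gap hypothesis bounds \<open>k\<close> below by a multiple of the
      logarithm of the group order, hence \<open>k\<close> tends to infinity.\<close>
    have "filterlim (\<lambda>N. real (card (carrier (G N)))) at_top sequentially"
      using lim filterlim_compose[OF filterlim_real_sequentially] by blast
    then have "filterlim (\<lambda>N. c * ln (real (card (carrier (G N))))) at_top sequentially"
      using assms by (intro filterlim_tendsto_pos_mult_at_top[OF tendsto_const] filterlim_compose[OF ln_at_top])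
    then have "filterlim (\<lambda>N. real (k N)) at_top sequentially"
    proof (rule filterlim_at_top_mono)
      show "\<forall>\<^sub>F N in sequentially. c * ln (real (card (carrier (G N)))) \<le> real (k N)"
      proof (intro always_eventually allI)
        fix N show "c * ln (real (card (carrier (G N)))) \<le> real (k N)" using gap[of N] by simp
      qed
    qed
    then have k: "filterlim k at_top sequentially"
      unfolding filterlim_sequentially_iff_filterlim_real .
    let ?p = "\<lambda>N. measure_pmf.prob (random_generators (G N) (k N))"
    have "(\<lambda>n. real n * s ^ n) \<longlonglongrightarrow> 0" using powser_times_n_limit_0[of s] s by simp
    from filterlim_compose[OF this k]
    have "(\<lambda>N. 1 - real (2 * m) * (real (k N) * s ^ k N)) \<longlonglongrightarrow> 1 - real (2 * m) * 0"
      by (intro tendsto_intros)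
    then have lower: "(\<lambda>N. 1 - real (2 * m) * (real (k N) * s ^ k N)) \<longlonglongrightarrow> 1" by simp
    \<comment> \<open>The bound for a single group requires order at least 2 and
      \<open>k \<ge> M\<close>, which hold from some index on.\<close>
    have ev: "\<forall>\<^sub>F N in sequentially. 1 - real (2 * m) * (real (k N) * s ^ k N) \<le> ?p N
        {zs. \<kappa> \<le> undirected_cayley_isoperimetric (G N) zs \<and> \<kappa> \<le> directed_cayley_isoperimetric (G N) zs}"
      using filterlim_at_top[THEN iffD1, OF lim, rule_format, of 2] filterlim_at_top[THEN iffD1, OF k, rule_format, of M]
    proof eventually_elim
      case (elim N)
      show ?case by (rule whp_bound[OF assms a s m M nil fin elim gap \<kappa>_def])
    qed
    \<comment> \<open>One event controls both graphs; its probability is squeezed between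
      \<open>lower\<close> and 1, and the two claims follow by monotonicity.\<close>
    have whp: "with_high_probability (\<lambda>N. random_generators (G N) (k N)) P"
      if P: "\<And>N zs. \<kappa> \<le> undirected_cayley_isoperimetric (G N) zs \<Longrightarrow> \<kappa> \<le> directed_cayley_isoperimetric (G N) zs \<Longrightarrow> P N zs" for P
      unfolding with_high_probability_def
    proof (rule tendsto_sandwich[OF _ _ lower tendsto_const])
      show "\<forall>\<^sub>F N in sequentially. 1 - real (2 * m) * (real (k N) * s ^ k N) \<le> ?p N {zs. P N zs}"
        using ev
      proof eventually_elim
        case (elim N)
        also have "?p N {zs. \<kappa> \<le> undirected_cayley_isoperimetric (G N) zs \<and> \<kappa> \<le> directed_cayley_isoperimetric (G N) zs}
            \<le> ?p N {zs. P N zs}"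
          using P by (intro measure_pmf.finite_measure_mono) auto
        finally show ?case .
      qed
    qed auto
    show ?thesis by (intro conjI whp)
  qed
  ultimately show ?thesis by blast
qed

end
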